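(* Suppose $\Sigma\subset C$ is a minimal surface spanning $d_1$, $d_2$ and a double helix $h_1,h_2$ (that is, $\partial\Sigma=d_1\cup d_2\cup h_1\cup h_2$) with $rot(h_i)=\theta$ for $i=1,2$. If $0\le\theta\le h/r$, then $\Sigma=H_C^\theta$.
   Context: All surfaces are two-dimensional, orientable and immersed in $\mathbb{R}^3$. A minimal surface is one with zero mean curvature; no assumption on the topological type of $\Sigma$ is made. $C\subset\mathbb{R}^3$ is a right circular solid cylinder of radius $r>0$ and height $h>0$; coordinates are chosen so that $C=\{(x,y,z) : x^2+y^2\le r^2,\ 0\le z\le h\}$. It is bounded by the top disk $D_1$ ($z=h$), the bottom disk $D_2$ ($z=0$), and the cylindrical side surface $S=\{x^2+y^2=r^2,\ 0\le z\le h\}$. $d_1\subset D_1$ and $d_2\subset D_2$ are fixed diameters of these disks; they are allowed to be parallel. A double helix is a pair of helices $h_1,h_2\subset S$ that are symmetric to each other with respect to the axis of $C$ (the rotation by $\pi$ about the axis interchanges them); here they join the endpoints of $d_2$ to the endpoints of $d_1$ (for rotation angle $0$ they are vertical segments). Rotation angle: for a curve $\gamma\subset S$ connecting two points $p,q\in S$, $rot(\gamma)$ is the oriented angle of the circular arc $proj(\gamma)$ joining $proj(p)$ to $proj(q)$, where $proj$ is the vertical projection of $S$ onto $\partial D_2$; that is, it is the total signed change of the (continuously lifted) polar angle along $\gamma$, curves between $d_2$ and $d_1$ being traversed from $d_2$ to $d_1$. For example, the helix $(r\cos u,r\sin u,bu)$, $0\le u\le\theta_0$, with $b>0$, has rotation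 angle $\theta_0$. $H_C^\theta$ denotes the compact piece of helicoid in $C$, ruled by horizontal segments through the axis of $C$, spanning $d_1$ and $d_2$, whose two boundary helices on $S$ have rotation angle $\theta$. Explicitly, $H_C^\theta=\{(s\cos(\varphi_0+\theta z/h),\, s\sin(\varphi_0+\theta z/h),\, z) : |s|\le r,\ 0\le z\le h\}$, where $\varphi_0$ is a direction angle of $d_2$ and $\varphi_0+\theta$ is a direction angle of $d_1$. $H_C^0$ is a planar rectangle. *)

theory Defs
  imports "HOL-Analysis.Analysis"
begin

section \<open>The cylinder, its diameters, double helices and helicoids\<close>

definition solid_cylinder :: "real \<Rightarrow> real \<Rightarrow> (real^3) set" where
  "solid_cylinder r h = {p. (p$1)\<^sup>2 + (p$2)\<^sup>2 \<le> r\<^sup>2 \<and> 0 \<le> p$3 \<and> p$3 \<le> h}"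

definition side_surface :: "real \<Rightarrow> real \<Rightarrow> (real^3) set" where
  "side_surface r h = {p. (p$1)\<^sup>2 + (p$2)\<^sup>2 = r\<^sup>2 \<and> 0 \<le> p$3 \<and> p$3 \<le> h}"

text \<open>The point with cylindrical coordinates \<open>(s, \<phi>, z)\<close>; negative \<open>s\<close> is allowed.\<close>

definition cyl_pt :: "real \<Rightarrow> real \<Rightarrow> real \<Rightarrow> real^3" where
  "cyl_pt s \<phi> z = vector [s * cos \<phi>, s * sin \<phi>, z]"

text \<open>The diameter with direction angle \<open>\<phi>\<close> of the horizontal disk of radius \<open>r\<close> at height \<open>z\<close>.\<close>

definition disk_diameter :: "real \<Rightarrow> real \<Rightarrow> real \<Rightarrow> (real^3) set" where
  "disk_diameter r z \<phi> = closed_segment (cyl_pt r \<phi> z) (cyl_pt r (\<phi> + pi) z)"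

text \<open>Curves are parametrised over \<open>{0..1}\<close>, as in the theory of paths. The angle and the height
  of a helix are affine in the parameter; vertical segments are included.\<close>

definition helix :: "real \<Rightarrow> (real \<Rightarrow> real^3) \<Rightarrow> bool" where
  "helix r \<gamma> \<longleftrightarrow> (\<exists>\<alpha> \<beta> c d. \<forall>t\<in>{0..1}. \<gamma> t = cyl_pt r (\<alpha> + \<beta> * t) (c + d * t))"

definition half_turn :: "real^3 \<Rightarrow> real^3" where
  "half_turn p = vector [- p$1, - p$2, p$3]"

text \<open>Two helices on the side surface, interchanged by the half turn about the axis, which lead
  from the two end points of \<open>d\<^sub>2\<close> to the two end points of \<open>d\<^sub>1\<close> (a segment determines the set of
  its end points).\<close>

definition double_helix ::
  "real \<Rightarrow> real \<Rightarrow> (real^3) set \<Rightarrow> (real^3) set \<Rightarrow> (real \<Rightarrow> real^3) \<Rightarrow> (real \<Rightarrow> real^3) \<Rightarrow> bool" where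
  "double_helix r h d\<^sub>1 d\<^sub>2 \<gamma>\<^sub>1 \<gamma>\<^sub>2 \<longleftrightarrow>
     helix r \<gamma>\<^sub>1 \<and> helix r \<gamma>\<^sub>2 \<and>
     path_image \<gamma>\<^sub>1 \<subseteq> side_surface r h \<and> path_image \<gamma>\<^sub>2 \<subseteq> side_surface r h \<and>
     half_turn ` path_image \<gamma>\<^sub>1 = path_image \<gamma>\<^sub>2 \<and>
     d\<^sub>2 = closed_segment (pathstart \<gamma>\<^sub>1) (pathstart \<gamma>\<^sub>2) \<and>
     d\<^sub>1 = closed_segment (pathfinish \<gamma>\<^sub>1) (pathfinish \<gamma>\<^sub>2)"

definition polar_lift :: "(real \<Rightarrow> real^3) \<Rightarrow> (real \<Rightarrow> real) \<Rightarrow> bool" where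
  "polar_lift \<gamma> \<phi> \<longleftrightarrow> continuous_on {0..1} \<phi> \<and>
     (\<forall>t\<in>{0..1}. \<gamma> t = cyl_pt (sqrt ((\<gamma> t$1)\<^sup>2 + (\<gamma> t$2)\<^sup>2)) (\<phi> t) (\<gamma> t$3))"

text \<open>The rotation angle. It is meaningful for continuous curves that do not meet the axis, for
  which a lift exists and any two lifts differ by a constant; see \<open>rot_eq\<close>.\<close>

definition rot :: "(real \<Rightarrow> real^3) \<Rightarrow> real" where
  "rot \<gamma> = (THE \<delta>. \<exists>\<phi>. polar_lift \<gamma> \<phi> \<and> \<delta> = \<phi> 1 - \<phi> 0)"

definition helicoid :: "real \<Rightarrow> real \<Rightarrow> real \<Rightarrow> real \<Rightarrow> (real^3) set" where
  "helicoid r h \<phi>\<^sub>0 \<theta> = {cyl_pt s (\<phi>\<^sub>0 + \<theta> * z / h) z | s z. \<bar>s\<bar> \<le> r \<and> 0 \<le> z \<and> z \<le> h}"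

lemma rot_eq:
  assumes lift: "polar_lift \<gamma> \<phi>"
    and off_axis: "\<And>t. t \<in> {0..1} \<Longrightarrow> (\<gamma> t$1)\<^sup>2 + (\<gamma> t$2)\<^sup>2 \<noteq> 0"
  shows "rot \<gamma> = \<phi> 1 - \<phi> 0"
  unfolding rot_def
proof (rule the_equality)
  show "\<exists>\<psi>. polar_lift \<gamma> \<psi> \<and> \<phi> 1 - \<phi> 0 = \<psi> 1 - \<psi> 0"
    using lift by blast
next
  fix \<delta> assume "\<exists>\<psi>. polar_lift \<gamma> \<psi> \<and> \<delta> = \<psi> 1 - \<psi> 0"
  then obtain \<psi> where lift': "polar_lift \<gamma> \<psi>" and \<delta>: "\<delta> = \<psi> 1 - \<psi> 0" by blast
  define g where "g t = (\<psi> t - \<phi> t) / (2 * pi)" for t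
  have "continuous_on {0..1} g"
    using lift lift' unfolding polar_lift_def g_def by (intro continuous_intros) auto
  moreover have "g t \<in> \<int>" if t: "t \<in> {0..1}" for t
  proof -
    define R where "R = sqrt ((\<gamma> t$1)\<^sup>2 + (\<gamma> t$2)\<^sup>2)"
    have "R \<noteq> 0" using off_axis[OF t] by (simp add: R_def)
    have "cyl_pt R (\<phi> t) (\<gamma> t$3) = cyl_pt R (\<psi> t) (\<gamma> t$3)"
      using lift lift' t unfolding polar_lift_def R_def by metis
    then have "(cyl_pt R (\<phi> t) (\<gamma> t$3))$1 = (cyl_pt R (\<psi> t) (\<gamma> t$3))$1"
      "(cyl_pt R (\<phi> t) (\<gamma> t$3))$2 = (cyl_pt R (\<psi> t) (\<gamma> t$3))$2" by simp_all
    with \<open>R \<noteq> 0\<close> have "sin (\<psi> t) = sin (\<phi> t) \<and> cos (\<psi> t) = cos (\<phi> t)"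
      by (simp add: cyl_pt_def)
    then obtain n :: int where "\<psi> t = \<phi> t + 2 * pi * n"
      by (auto simp: sin_cos_eq_iff)
    then show ?thesis by (simp add: g_def)
  qed
  ultimately have "g constant_on {0..1}"
    by (intro continuous_discrete_range_constant)
      (auto intro!: exI[of _ "1::real"] Ints_nonzero_abs_ge1)
  then have "g 1 = g 0" by (auto simp: constant_on_def)
  then show "\<delta> = \<phi> 1 - \<phi> 0" by (simp add: g_def \<delta> field_simps)
qed


section \<open>Immersed surfaces with boundary\<close>

definition surface_with_boundary :: "'a topology \<Rightarrow> bool" where
  "surface_with_boundary M \<longleftrightarrow>
     Hausdorff_space M \<and> second_countable M \<and>
     (\<forall>p\<in>topspace M. \<exists>U V. openin M U \<and> p \<in> U \<and>
        openin (top_of_set {x::real^2. 0 \<le> x$2}) V \<and>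
        subtopology M U homeomorphic_space top_of_set V)"

definition surface_interior :: "'a topology \<Rightarrow> 'a set" where
  "surface_interior M = {p \<in> topspace M. \<exists>U (V::(real^2) set). openin M U \<and> p \<in> U \<and> open V \<and>
     subtopology M U homeomorphic_space top_of_set V}"

definition surface_boundary :: "'a topology \<Rightarrow> 'a set" where
  "surface_boundary M = topspace M - surface_interior M"

definition partial :: "2 \<Rightarrow> (real^2 \<Rightarrow> 'b::real_normed_vector) \<Rightarrow> real^2 \<Rightarrow> 'b" where
  "partial i f x = frechet_derivative f (at x) (axis i 1)"

primrec C_on :: "nat \<Rightarrow> (real^2) set \<Rightarrow> (real^2 \<Rightarrow> 'b::real_normed_vector) \<Rightarrow> bool" where
  "C_on 0 U f \<longleftrightarrow> continuous_on U f"
| "C_on (Suc k) U f \<longleftrightarrow> f differentiable_on U \<and> (\<forall>i. C_on k U (partial i f))"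

text \<open>A coherently oriented \<open>C\<^sup>2\<close> atlas of the interior. Its members \<open>(U, \<psi>)\<close> are local
  parametrisations (inverses of charts) \<open>\<psi>\<close> with domain \<open>U\<close>. No differentiable structure is
  imposed at the boundary, where a surface spanning a curve with corners has none.\<close>

definition oriented_atlas :: "'a topology \<Rightarrow> ((real^2) set \<times> (real^2 \<Rightarrow> 'a)) set \<Rightarrow> bool" where
  "oriented_atlas M A \<longleftrightarrow>
     (\<forall>(U, \<psi>)\<in>A. open U \<and> openin M (\<psi> ` U) \<and>
        homeomorphic_map (top_of_set U) (subtopology M (\<psi> ` U)) \<psi>) \<and>
     (\<Union>(U, \<psi>)\<in>A. \<psi> ` U) = surface_interior M \<and>
     (\<forall>(U, \<psi>)\<in>A. \<forall>(U', \<psi>')\<in>A.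
        let W = {x \<in> U. \<psi> x \<in> \<psi>' ` U'}; \<tau> = inv_into U' \<psi>' \<circ> \<psi>
        in C_on 2 W \<tau> \<and> (\<forall>x\<in>W. det (jacobian \<tau> (at x)) > 0))"

text \<open>Immersions are \<open>C\<^sup>2\<close> in the interior and continuous up to the boundary.\<close>

definition immersion ::
  "'a topology \<Rightarrow> ((real^2) set \<times> (real^2 \<Rightarrow> 'a)) set \<Rightarrow> ('a \<Rightarrow> real^3) \<Rightarrow> bool" where
  "immersion M A X \<longleftrightarrow> continuous_map M euclidean X \<and>
     (\<forall>(U, \<psi>)\<in>A. C_on 2 U (X \<circ> \<psi>) \<and>
        (\<forall>x\<in>U. inj (frechet_derivative (X \<circ> \<psi>) (at x))))"

definition unit_normal :: "(real^2 \<Rightarrow> real^3) \<Rightarrow> real^2 \<Rightarrow> real^3" where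
  "unit_normal F x = sgn (cross3 (partial 1 F x) (partial 2 F x))"

definition first_form :: "(real^2 \<Rightarrow> real^3) \<Rightarrow> real^2 \<Rightarrow> 2 \<Rightarrow> 2 \<Rightarrow> real" where
  "first_form F x i j = partial i F x \<bullet> partial j F x"

definition second_form :: "(real^2 \<Rightarrow> real^3) \<Rightarrow> real^2 \<Rightarrow> 2 \<Rightarrow> 2 \<Rightarrow> real" where
  "second_form F x i j = partial i (partial j F) x \<bullet> unit_normal F x"

text \<open>The mean of the principal curvatures of the parametrised surface \<open>F\<close>.\<close>

definition mean_curvature :: "(real^2 \<Rightarrow> real^3) \<Rightarrow> real^2 \<Rightarrow> real" where
  "mean_curvature F x =
     (second_form F x 1 1 * first_form F x 2 2 - 2 * second_form F x 1 2 * first_form F x 1 2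
        + second_form F x 2 2 * first_form F x 1 1)
     / (2 * (first_form F x 1 1 * first_form F x 2 2 - (first_form F x 1 2)\<^sup>2))"

text \<open>Compact orientable minimal surfaces with boundary, immersed in space by \<open>X\<close>. The surface
  need not be connected.\<close>

definition minimal_surface ::
  "'a topology \<Rightarrow> ((real^2) set \<times> (real^2 \<Rightarrow> 'a)) set \<Rightarrow> ('a \<Rightarrow> real^3) \<Rightarrow> bool" where
  "minimal_surface M A X \<longleftrightarrow>
     surface_with_boundary M \<and> compact_space M \<and> oriented_atlas M A \<and> immersion M A X \<and>
     (\<forall>(U, \<psi>)\<in>A. \<forall>x\<in>U. mean_curvature (X \<circ> \<psi>) x = 0)"

text \<open>The boundary of the immersed surface is the curve \<open>\<Gamma>\<close>, traversed once.\<close>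

definition spans :: "'a topology \<Rightarrow> ('a \<Rightarrow> real^3) \<Rightarrow> (real^3) set \<Rightarrow> bool" where
  "spans M X \<Gamma> \<longleftrightarrow> bij_betw X (surface_boundary M) \<Gamma>"

end

theory Submission
  imports Defs
begin

text \<open>
  Put \<open>k = \<theta> / h\<close> and \<open>f p = x sin (\<phi>\<^sub>0 + k z) - y cos (\<phi>\<^sub>0 + k z)\<close>. Within the cylinder the helicoid is
  the zero set of \<open>f\<close>, and \<open>f\<close> vanishes on the prescribed boundary. Two things are to be shown: the
  surface lies in the zero set of \<open>f\<close>, and it covers the helicoid exactly once.

  For the first, \<open>f\<close> itself obeys no maximum principle on minimal surfaces, but the quotient
  \<open>f / g\<close> with \<open>g = R - x\<^sup>2 - y\<^sup>2\<close> does as long as \<open>r\<^sup>2 < R\<close> and \<open>k\<^sup>2 R < 2\<close>. The hypothesis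
  \<open>\<theta> \<le> h / r\<close> says \<open>k r \<le> 1\<close>, which leaves room for such an \<open>R\<close>; the choice here is
  \<open>R = 3/2 r\<^sup>2\<close>. Suppose that \<open>f / g\<close> has a maximum \<open>t > 0\<close> at an interior point of the surface.
  Then \<open>f - t g\<close>, restricted to the surface, has a maximum there. So its gradient is normal to the
  surface, and the trace of its Hessian over the tangent plane is at most \<open>0\<close>: this trace is the
  Laplacian on the surface, because the mean curvature vanishes. However, with the coordinate
  \<open>m = x cos (\<phi>\<^sub>0 + k z) + y sin (\<phi>\<^sub>0 + k z)\<close> along the rulings, that trace times the squared length
  of the gradient is
  \<open>t (2 - k\<^sup>2 g) ((2 t m)\<^sup>2 + (1 + 2 t f)\<^sup>2) > 0\<close>. Geometrically, the level surfaces of \<open>f / g\<close> are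
  barriers which fill the cylinder on either side of the helicoid. This is
  \<open>no_positive_maximum_on_minimal_surface\<close>, with the algebra in \<open>gradient_trace_identity\<close>. Adding
  \<open>\<pi>\<close> to \<open>\<phi>\<^sub>0\<close> changes the sign of \<open>f\<close>, hence \<open>f = 0\<close> on the surface.

  For the second, \<open>Q = (m, z)\<close> identifies the helicoid with a rectangle. On the interior of the
  surface \<open>Q\<close> is a local homeomorphism into the open rectangle, and it maps the boundary
  bijectively onto the frontier. By compactness the open rectangle is evenly covered, and since
  rectangles are simply connected, every point over a closed rectangle inside it lies on a continuous
  section over that rectangle (\<open>liftable_rectangle\<close>), so that all fibres have equally many points. There is only one sheet,
  because the surface looks like a half disc near a boundary point: two points of a fibre close to
  the boundary can be joined inside this half disc, and the section through one of them must follow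
  the connecting set to the other (\<open>bij_betw_over_box\<close>).
\<close>

section \<open>Partial derivatives in the plane\<close>

lemma differentiable_on_openD:
  assumes "F differentiable_on U" "open U" "x \<in> U"
  shows "F differentiable (at x)"
  using assms by (metis at_within_open differentiable_on_def)

lemma vec2_decomp: "v = v$1 *\<^sub>R axis 1 1 + v$2 *\<^sub>R axis 2 (1::real)" for v :: "real^2"
  by (simp add: vec_eq_iff forall_2 axis_def)

lemma has_derivative_partials:
  assumes "F differentiable_on U" "open U" "x \<in> U"
  shows "(F has_derivative (\<lambda>v. v$1 *\<^sub>R partial 1 F x + v$2 *\<^sub>R partial 2 F x)) (at x)"
proof -
  have "F differentiable (at x)"
    using assms differentiable_on_openD by blast
  then have D: "(F has_derivative frechet_derivative F (at x)) (at x)"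
    using frechet_derivative_works by blast
  interpret bounded_linear "frechet_derivative F (at x)"
    using D has_derivative_bounded_linear by blast
  have "frechet_derivative F (at x) v = v$1 *\<^sub>R partial 1 F x + v$2 *\<^sub>R partial 2 F x" for v
    unfolding partial_def by (subst vec2_decomp[of v]) (simp only: add scaleR)
  then have "frechet_derivative F (at x) = (\<lambda>v. v$1 *\<^sub>R partial 1 F x + v$2 *\<^sub>R partial 2 F x)"
    by blast
  with D show ?thesis by simp
qed

lemma has_vector_derivative_line:
  assumes "F differentiable_on U" "open U" "x + s *\<^sub>R v \<in> U"
  shows "((\<lambda>\<tau>. F (x + \<tau> *\<^sub>R v)) has_vector_derivative
     v$1 *\<^sub>R partial 1 F (x + s *\<^sub>R v) + v$2 *\<^sub>R partial 2 F (x + s *\<^sub>R v)) (at s)"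
proof -
  have "((\<lambda>\<tau>. x + \<tau> *\<^sub>R v) has_vector_derivative v) (at s)"
    by (auto intro!: derivative_eq_intros)
  then have "((\<lambda>\<tau>. x + \<tau> *\<^sub>R v) has_derivative (\<lambda>\<tau>. \<tau> *\<^sub>R v)) (at s)"
    by (simp add: has_vector_derivative_def)
  from has_derivative_compose[OF this has_derivative_partials[OF assms]]
  show ?thesis unfolding has_vector_derivative_def
    by (simp add: scaleR_right_distrib mult.commute)
qed

lemma partial_eqI:
  assumes "(F has_derivative D) (at x)" shows "partial i F x = D (axis i 1)"
  unfolding partial_def by (simp add: frechet_derivative_at[OF assms, symmetric])

lemma partial_component:
  fixes F :: "real^2 \<Rightarrow> real^'n"
  assumes "F differentiable (at x)"
  shows "partial i (\<lambda>x. F x $ j) x = partial i F x $ j"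
proof -
  have "(F has_derivative frechet_derivative F (at x)) (at x)"
    using assms frechet_derivative_works by blast
  then have "((\<lambda>x. F x $ j) has_derivative (\<lambda>v. frechet_derivative F (at x) v $ j)) (at x)"
    by (rule bounded_linear.has_derivative[OF bounded_linear_vec_nth])
  from partial_eqI[OF this] show ?thesis by (simp add: partial_def)
qed

text \<open>The heart of Schwarz's theorem: the second-order difference of \<open>u\<close> on a small square is symmetric in
  the two directions, and two applications of the mean value theorem turn it into a mixed partial
  derivative at some point of the square, in whichever order the directions are taken.\<close>

lemma mixed_difference_mean_value:
  fixes u :: "real^2 \<Rightarrow> real"
  assumes du: "u differentiable_on U" and ddu: "partial i u differentiable_on U"
    and U: "open U" and s: "s > 0" and ball: "cball x (2 * s) \<subseteq> U"
  shows "\<exists>y\<in>cball x (2 * s). u (x + s *\<^sub>R axis i 1 + s *\<^sub>R axis j 1) - u (x + s *\<^sub>R axis i 1)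
      - u (x + s *\<^sub>R axis j 1) + u x = s^2 * partial j (partial i u) y"
proof -
  have D: "((\<lambda>\<tau>. f (a + \<tau> *\<^sub>R axis k 1)) has_real_derivative partial k f (a + t *\<^sub>R axis k 1)) (at t)"
    if "f differentiable_on U" "a + t *\<^sub>R axis k 1 \<in> U" for f :: "real^2 \<Rightarrow> real" and a t k
  proof -
    have k: "k = 1 \<or> k = 2" using exhaust_2 by blast
    show ?thesis
      using has_vector_derivative_line[OF that(1) U, of a t "axis k 1"] that(2) k
      by (auto simp: has_real_derivative_iff_has_vector_derivative axis_def)
  qed
  have inU: "x + a *\<^sub>R axis i 1 + b *\<^sub>R axis j 1 \<in> cball x (2 * s)" if "0 \<le> a" "a \<le> s" "0 \<le> b" "b \<le> s" for a b
  proof -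
    have "norm (a *\<^sub>R axis i (1::real) + b *\<^sub>R axis j (1::real) :: real^2) \<le> a + b"
      using norm_triangle_ineq[of "a *\<^sub>R axis i (1::real) :: real^2" "b *\<^sub>R axis j (1::real)"] that by simp
    then show ?thesis using that by (simp add: dist_norm norm_minus_commute algebra_simps)
  qed
  \<comment> \<open>The difference in direction \<open>j\<close>, as a function of the position along direction \<open>i\<close>.\<close>
  define w where "w \<tau> = u (x + s *\<^sub>R axis j 1 + \<tau> *\<^sub>R axis i 1) - u (x + \<tau> *\<^sub>R axis i 1)" for \<tau>
  have "\<exists>\<xi>. 0 < \<xi> \<and> \<xi> < s \<and> w s - w 0 = (s - 0) *
      (partial i u (x + s *\<^sub>R axis j 1 + \<xi> *\<^sub>R axis i 1) - partial i u (x + \<xi> *\<^sub>R axis i 1))"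
    using s
  proof (intro MVT2)
    fix t assume t: "0 \<le> t" "t \<le> s"
    have "x + s *\<^sub>R axis j 1 + t *\<^sub>R axis i 1 \<in> U" "x + t *\<^sub>R axis i 1 \<in> U"
      using inU[of t s] inU[of t 0] t s ball by (auto simp: algebra_simps)
    then show "(w has_real_derivative partial i u (x + s *\<^sub>R axis j 1 + t *\<^sub>R axis i 1)
        - partial i u (x + t *\<^sub>R axis i 1)) (at t)"
      unfolding w_def using du by (intro DERIV_diff D)
  qed
  then obtain \<xi> where \<xi>: "0 < \<xi>" "\<xi> < s" and w: "w s - w 0 = s *
      (partial i u (x + s *\<^sub>R axis j 1 + \<xi> *\<^sub>R axis i 1) - partial i u (x + \<xi> *\<^sub>R axis i 1))" by auto
  define a where "a = x + \<xi> *\<^sub>R axis i 1"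
  have "\<exists>\<eta>. 0 < \<eta> \<and> \<eta> < s \<and> partial i u (a + s *\<^sub>R axis j 1) - partial i u (a + 0 *\<^sub>R axis j 1) = (s - 0) *
      partial j (partial i u) (a + \<eta> *\<^sub>R axis j 1)"
    using s
  proof (intro MVT2)
    fix t assume t: "0 \<le> t" "t \<le> s"
    have "a + t *\<^sub>R axis j 1 \<in> U"
      using inU[of \<xi> t] t \<xi> ball by (auto simp: a_def)
    then show "((\<lambda>b. partial i u (a + b *\<^sub>R axis j 1)) has_real_derivative
        partial j (partial i u) (a + t *\<^sub>R axis j 1)) (at t)"
      using ddu by (intro D)
  qed
  then obtain \<eta> where \<eta>: "0 < \<eta>" "\<eta> < s" "partial i u (a + s *\<^sub>R axis j 1) - partial i u a = s *
      partial j (partial i u) (a + \<eta> *\<^sub>R axis j 1)" by auto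
  show ?thesis
  proof (rule bexI)
    show "a + \<eta> *\<^sub>R axis j 1 \<in> cball x (2 * s)" using inU[of \<xi> \<eta>] \<xi> \<eta> by (simp add: a_def)
    show "u (x + s *\<^sub>R axis i 1 + s *\<^sub>R axis j 1) - u (x + s *\<^sub>R axis i 1)
      - u (x + s *\<^sub>R axis j 1) + u x = s^2 * partial j (partial i u) (a + \<eta> *\<^sub>R axis j 1)"
      using w \<eta>(3) by (simp add: w_def a_def power2_eq_square algebra_simps)
  qed
qed

text \<open>If the mixed derivatives differed at \<open>x\<close>, continuity would separate them on a whole square around
  \<open>x\<close>, where they share a value up to the choice of the point by \<open>mixed_difference_mean_value\<close>.\<close>

lemma symmetric_mixed_partials_real:
  fixes u :: "real^2 \<Rightarrow> real"
  assumes C2: "C_on 2 U u" and U: "open U" and x: "x \<in> U"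
  shows "partial i (partial j u) x = partial j (partial i u) x"
proof (rule ccontr)
  assume ne: "\<not> ?thesis"
  have du: "u differentiable_on U" and ddu: "\<And>i. partial i u differentiable_on U"
    and cont: "\<And>i j. continuous_on U (partial i (partial j u))"
    using C2 by (auto simp: numeral_2_eq_2)
  define e where "e = dist (partial i (partial j u) x) (partial j (partial i u) x) / 2"
  have e: "e > 0" using ne by (simp add: e_def)
  have near: "\<exists>d>0. \<forall>y. dist y x < d \<longrightarrow> dist (partial i (partial j u) y) (partial i (partial j u) x) < e" for i j
  proof -
    have "isCont (partial i (partial j u)) x"
      using cont U x continuous_on_eq_continuous_at by blast
    then show ?thesis using e unfolding continuous_at_eps_delta by simp
  qed
  obtain d1 where d1: "d1 > 0" "\<forall>y. dist y x < d1 \<longrightarrow> dist (partial i (partial j u) y) (partial i (partial j u) x) < e"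
    using near by blast
  obtain d2 where d2: "d2 > 0" "\<forall>y. dist y x < d2 \<longrightarrow> dist (partial j (partial i u) y) (partial j (partial i u) x) < e"
    using near by blast
  obtain d0 where d0: "d0 > 0" "cball x d0 \<subseteq> U" using U x open_contains_cball by blast
  define s where "s = min (min d1 d2) d0 / 3"
  have s: "s > 0" "2 * s < d1" "2 * s < d2" "2 * s \<le> d0" using d0 d1 d2 by (auto simp: s_def)
  have ball: "cball x (2 * s) \<subseteq> U" using s d0 by (meson order_trans subset_cball)
  obtain y where y: "y \<in> cball x (2 * s)" "u (x + s *\<^sub>R axis i 1 + s *\<^sub>R axis j 1) - u (x + s *\<^sub>R axis i 1)
      - u (x + s *\<^sub>R axis j 1) + u x = s^2 * partial j (partial i u) y"
    using mixed_difference_mean_value[OF du ddu U s(1) ball] by blast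
  obtain z where z: "z \<in> cball x (2 * s)" "u (x + s *\<^sub>R axis j 1 + s *\<^sub>R axis i 1) - u (x + s *\<^sub>R axis j 1)
      - u (x + s *\<^sub>R axis i 1) + u x = s^2 * partial i (partial j u) z"
    using mixed_difference_mean_value[OF du ddu U s(1) ball] by blast
  have "s^2 * partial j (partial i u) y = s^2 * partial i (partial j u) z"
    using y(2) z(2) by (simp add: algebra_simps)
  then have "partial j (partial i u) y = partial i (partial j u) z" using s(1) by simp
  moreover have "dist (partial j (partial i u) y) (partial j (partial i u) x) < e"
  proof -
    have "dist y x < d2" using y(1) s by (simp add: dist_commute)
    with d2(2) show ?thesis by blast
  qed
  moreover have "dist (partial i (partial j u) z) (partial i (partial j u) x) < e"
  proof -
    have "dist z x < d1" using z(1) s by (simp add: dist_commute)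
    with d1(2) show ?thesis by blast
  qed
  ultimately have "dist (partial j (partial i u) x) (partial i (partial j u) x) < e + e"
    by (metis dist_commute dist_triangle_less_add)
  then show False by (simp add: e_def dist_commute)
qed

lemma partial_cong:
  assumes "open U" "x \<in> U" "\<And>x. x \<in> U \<Longrightarrow> f x = g x"
  shows "partial i f x = partial i g x"
proof -
  have "(f has_derivative D) (at x) \<longleftrightarrow> (g has_derivative D) (at x)" for D
    using assms by (auto intro: has_derivative_transform_within_open[OF _ assms(1,2)])
  then show ?thesis by (simp add: partial_def frechet_derivative_def)
qed

text \<open>\<open>C_on\<close> is defined through total derivatives of functions on the whole plane; on an open set only
  the values there matter.\<close>

lemma C_on_cong:
  assumes "open U" "\<And>x. x \<in> U \<Longrightarrow> f x = g x"
  shows "C_on k U f \<longleftrightarrow> C_on k U g"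
  using assms(2)
proof (induction k arbitrary: f g)
  case 0 then show ?case by (simp cong: continuous_on_cong)
next
  case (Suc k)
  have 1: "C_on k U (partial i f) = C_on k U (partial i g)" for i
    by (rule Suc.IH) (rule partial_cong[OF assms(1)], use Suc.prems in auto)
  have "f differentiable_on U \<longleftrightarrow> g differentiable_on U"
    unfolding differentiable_on_def
    using differentiable_transform_within[OF _ zero_less_one, of f _ U g]
      differentiable_transform_within[OF _ zero_less_one, of g _ U f] Suc.prems by metis
  then show ?case by (simp only: C_on.simps 1)
qed

lemma differentiable_component:
  fixes F :: "real^2 \<Rightarrow> real^'n"
  assumes "F differentiable (at x)" shows "(\<lambda>x. F x $ j) differentiable (at x)"
  using assms unfolding differentiable_def by (blast intro: bounded_linear.has_derivative[OF bounded_linear_vec_nth])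

lemma C_on_component:
  fixes F :: "real^2 \<Rightarrow> real^'n"
  assumes "open U" "C_on k U F"
  shows "C_on k U (\<lambda>x. F x $ j)"
  using assms(2)
proof (induction k arbitrary: F)
  case 0 then show ?case by (simp add: continuous_on_component)
next
  case (Suc k)
  have F: "F differentiable_on U" using Suc.prems by simp
  then have at: "F differentiable (at x)" if "x \<in> U" for x
    using that assms(1) F differentiable_on_openD by blast
  then have "(\<lambda>x. F x $ j) differentiable_on U"
    unfolding differentiable_on_def using differentiable_at_withinI[OF differentiable_component[OF at]] by blast
  moreover have "C_on k U (partial i (\<lambda>x. F x $ j))" for i
  proof -
    have "C_on k U (\<lambda>x. partial i F x $ j)" by (rule Suc.IH) (use Suc.prems in simp)
    then show ?thesis
      using C_on_cong[OF assms(1), of "partial i (\<lambda>x. F x $ j)" "\<lambda>x. partial i F x $ j" k]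
        partial_component[OF at] by blast
  qed
  ultimately show ?case by simp
qed

lemma symmetric_mixed_partials:
  fixes F :: "real^2 \<Rightarrow> real^'n"
  assumes C2: "C_on 2 U F" and U: "open U" and x: "x \<in> U"
  shows "partial i (partial j F) x = partial j (partial i F) x"
proof -
  have D: "F differentiable (at x)" if "x \<in> U" for x
    using that U C2 differentiable_on_openD by (auto simp: numeral_2_eq_2)
  have DD: "partial i F differentiable (at x)" for i
    using x U C2 differentiable_on_openD by (auto simp: numeral_2_eq_2)
  have *: "partial i (partial j F) x $ l = partial i (partial j (\<lambda>x. F x $ l)) x" for i j l
  proof -
    have "partial i (partial j F) x $ l = partial i (\<lambda>x. partial j F x $ l) x"
      by (rule partial_component[OF DD, symmetric])
    also have "\<dots> = partial i (partial j (\<lambda>x. F x $ l)) x"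
      using partial_component[OF D] by (intro partial_cong[OF U x]) simp
    finally show ?thesis .
  qed
  show ?thesis
    unfolding vec_eq_iff *
    by (intro allI symmetric_mixed_partials_real[OF C_on_component[OF U C2] U x])
qed

section \<open>The second variation of the helicoid function\<close>

lemma second_derivative_le_0_at_local_max:
  fixes u :: "real \<Rightarrow> real"
  assumes d: "d > 0" and du: "\<And>\<tau>. \<bar>\<tau>\<bar> < d \<Longrightarrow> (u has_real_derivative u' \<tau>) (at \<tau>)"
    and ddu: "(u' has_real_derivative D) (at 0)" and max: "\<And>\<tau>. \<bar>\<tau>\<bar> < d \<Longrightarrow> u \<tau> \<le> u 0"
  shows "u' 0 = 0" "D \<le> 0"
proof -
  show 0: "u' 0 = 0"
    using DERIV_local_max[OF du d] max d by simp
  show "D \<le> 0"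
  proof (rule ccontr)
    assume "\<not> D \<le> 0"
    then obtain e where e: "e > 0" "\<And>s. 0 < s \<Longrightarrow> s < e \<Longrightarrow> u' 0 < u' (0 + s)"
      using DERIV_pos_inc_right[OF ddu] by force
    define s where "s = min e d / 2"
    have s: "0 < s" "s < e" "s < d" using e d by (auto simp: s_def min_def)
    have "\<exists>\<xi>. 0 < \<xi> \<and> \<xi> < s \<and> u s - u 0 = (s - 0) * u' \<xi>"
      using s by (intro MVT2 du) auto
    then obtain \<xi> where \<xi>: "0 < \<xi>" "\<xi> < s" "u s - u 0 = s * u' \<xi>" by auto
    then have "u' \<xi> > 0" using e(2)[of \<xi>] s 0 by simp
    then have "s * u' \<xi> > 0" using s by simp
    with \<xi>(3) max[of s] s show False by simp
  qed
qed

text \<open>At a point with \<open>x = s cos \<psi>\<close> and \<open>y = s sin \<psi>\<close> the value is \<open>s sin (\<phi> + k z - \<psi>)\<close>, the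
  signed distance from the ruling at height \<open>z\<close> of the helicoid with initial angle \<open>\<phi>\<close> and twist
  \<open>k\<close> per unit height.\<close>

definition helicoid_fun :: "real \<Rightarrow> real \<Rightarrow> real^3 \<Rightarrow> real" where
  "helicoid_fun k \<phi> p = p$1 * sin (\<phi> + k * p$3) - p$2 * cos (\<phi> + k * p$3)"

text \<open>A symmetric bilinear form on space, given by the entries of its matrix. The \<open>(1,2)\<close> entry is zero
  since Hessians of \<open>helicoid_fun k \<phi> p + t (x\<^sup>2 + y\<^sup>2)\<close> have this shape.\<close>

definition sym_form :: "real \<Rightarrow> real \<Rightarrow> real \<Rightarrow> real \<Rightarrow> real \<Rightarrow> real^3 \<Rightarrow> real^3 \<Rightarrow> real" where
  "sym_form m\<^sub>1 m\<^sub>2 m\<^sub>3 m\<^sub>1\<^sub>3 m\<^sub>2\<^sub>3 v w = m\<^sub>1 * v$1 * w$1 + m\<^sub>2 * v$2 * w$2 + m\<^sub>3 * v$3 * w$3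
     + m\<^sub>1\<^sub>3 * (v$1 * w$3 + v$3 * w$1) + m\<^sub>2\<^sub>3 * (v$2 * w$3 + v$3 * w$2)"

text \<open>For tangent vectors \<open>a, b\<close> with normal \<open>n = a \<times> b\<close>, the matrix \<open>|n|\<^sup>2 I - n n\<^sup>T\<close> equals
  \<open>(b \<bullet> b) a a\<^sup>T - (a \<bullet> b) (a b\<^sup>T + b a\<^sup>T) + (a \<bullet> a) b b\<^sup>T\<close>. So both sides are \<open>|n|\<^sup>2\<close> times the
  trace of the form over the tangent plane, once in terms of the first fundamental form and once as
  the full trace minus the normal part.\<close>

lemma tangential_trace:
  "(b \<bullet> b) * sym_form m\<^sub>1 m\<^sub>2 m\<^sub>3 m\<^sub>1\<^sub>3 m\<^sub>2\<^sub>3 a a - 2 * (a \<bullet> b) * sym_form m\<^sub>1 m\<^sub>2 m\<^sub>3 m\<^sub>1\<^sub>3 m\<^sub>2\<^sub>3 a b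
     + (a \<bullet> a) * sym_form m\<^sub>1 m\<^sub>2 m\<^sub>3 m\<^sub>1\<^sub>3 m\<^sub>2\<^sub>3 b b
   = (m\<^sub>1 + m\<^sub>2 + m\<^sub>3) * (cross3 a b \<bullet> cross3 a b)
     - sym_form m\<^sub>1 m\<^sub>2 m\<^sub>3 m\<^sub>1\<^sub>3 m\<^sub>2\<^sub>3 (cross3 a b) (cross3 a b)"
  unfolding sym_form_def cross3_def inner_vec_def
  by (simp add: sum_3 algebra_simps)

text \<open>By Lagrange's formula \<open>v \<times> (a \<times> b)\<close> is a combination of \<open>a\<close> and \<open>b\<close> with the coefficients
  \<open>v \<bullet> b\<close> and \<open>- (v \<bullet> a)\<close>.\<close>

lemma orthogonal_imp_multiple_of_cross:
  fixes a b v :: "real^3"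
  assumes "cross3 a b \<noteq> 0" "v \<bullet> a = 0" "v \<bullet> b = 0"
  obtains c where "v = c *\<^sub>R cross3 a b"
proof -
  have "cross3 v (cross3 a b) = 0"
    using assms Lagrange[of v a b] by (simp add: inner_commute)
  then have "collinear {0, cross3 a b, v}"
    by (metis cross_eq_0 insert_commute)
  then show ?thesis using that assms(1) by (metis collinear_lemma scaleR_zero_left)
qed

text \<open>The first and second derivative tests for \<open>helicoid_fun + t (x\<^sup>2 + y\<^sup>2)\<close> along the straight line
  with direction \<open>v\<close> in the parameter plane. Here \<open>p\<close> and \<open>q\<close> are the velocity and the acceleration
  in space of the image of that line, and the second derivative is \<open>Hess (p, p) + grad \<bullet> q\<close>.\<close>

lemma helicoid_fun_second_variation_at_max:
  fixes Y :: "real^2 \<Rightarrow> real^3" and v :: "real^2"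
  assumes Y: "C_on 2 U Y" and U: "open U" and x: "x \<in> U"
    and max: "\<And>y. y \<in> U \<Longrightarrow> helicoid_fun k \<phi> (Y y) + t * ((Y y$1)\<^sup>2 + (Y y$2)\<^sup>2)
        \<le> helicoid_fun k \<phi> (Y x) + t * ((Y x$1)\<^sup>2 + (Y x$2)\<^sup>2)"
  defines "p \<equiv> v$1 *\<^sub>R partial 1 Y x + v$2 *\<^sub>R partial 2 Y x"
    and "q \<equiv> (v$1)\<^sup>2 *\<^sub>R partial 1 (partial 1 Y) x + (2 * v$1 * v$2) *\<^sub>R partial 1 (partial 2 Y) x
            + (v$2)\<^sup>2 *\<^sub>R partial 2 (partial 2 Y) x"
    and "C \<equiv> cos (\<phi> + k * Y x$3)" and "S \<equiv> sin (\<phi> + k * Y x$3)"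
  defines "grad \<equiv> vector [S + 2 * t * Y x$1, - C + 2 * t * Y x$2, k * (Y x$1 * C + Y x$2 * S)]"
  shows "grad \<bullet> p = 0"
    and "sym_form (2*t) (2*t) (- k\<^sup>2 * helicoid_fun k \<phi> (Y x)) (k * C) (k * S) p p + grad \<bullet> q \<le> 0"
proof -
  have dY: "Y differentiable_on U" "\<And>i. partial i Y differentiable_on U"
    using Y by (auto simp: numeral_2_eq_2)
  obtain e where e: "e > 0" "ball x e \<subseteq> U" using U x open_contains_ball by blast
  \<comment> \<open>Adding \<open>1\<close> to the norm keeps the quotient meaningful for \<open>v = 0\<close>.\<close>
  define d where "d = e / (norm v + 1)"
  have "norm v + 1 > 0" by (simp add: add_nonneg_pos)
  then have d: "d > 0" using e by (simp add: d_def)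
  have inU: "x + \<tau> *\<^sub>R v \<in> U" if "\<bar>\<tau>\<bar> < d" for \<tau>
  proof -
    have "\<bar>\<tau>\<bar> * norm v \<le> \<bar>\<tau>\<bar> * (norm v + 1)" by (simp add: mult_left_mono)
    also have "\<dots> < e" using that \<open>norm v + 1 > 0\<close> by (simp add: d_def field_simps)
    finally show ?thesis using e(2) by (auto simp: dist_norm)
  qed
  define P where "P \<tau> = v$1 *\<^sub>R partial 1 Y (x + \<tau> *\<^sub>R v) + v$2 *\<^sub>R partial 2 Y (x + \<tau> *\<^sub>R v)" for \<tau>
  have vec_comp: "((\<lambda>\<tau>. f \<tau> $ i) has_real_derivative f' $ i) (at s)"
    if "(f has_vector_derivative f') (at s)" for f :: "real \<Rightarrow> real^3" and f' s i
    using bounded_linear.has_vector_derivative[OF bounded_linear_vec_nth that]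
    by (simp add: has_real_derivative_iff_has_vector_derivative)
  have dy: "((\<lambda>\<tau>. Y (x + \<tau> *\<^sub>R v) $ i) has_real_derivative P \<tau> $ i) (at \<tau>)" if "\<bar>\<tau>\<bar> < d" for \<tau> i
    unfolding P_def by (intro vec_comp has_vector_derivative_line[OF dY(1) U] inU that)
  have sym: "partial 2 (partial 1 Y) x = partial 1 (partial 2 Y) x"
    by (rule symmetric_mixed_partials[OF Y U x])
  have "(P has_vector_derivative
     v$1 *\<^sub>R (v$1 *\<^sub>R partial 1 (partial 1 Y) (x + 0 *\<^sub>R v) + v$2 *\<^sub>R partial 2 (partial 1 Y) (x + 0 *\<^sub>R v))
   + v$2 *\<^sub>R (v$1 *\<^sub>R partial 1 (partial 2 Y) (x + 0 *\<^sub>R v) + v$2 *\<^sub>R partial 2 (partial 2 Y) (x + 0 *\<^sub>R v))) (at 0)"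
    unfolding P_def using x
    by (intro has_vector_derivative_add has_vector_derivative_line[OF dY(2) U, THEN
          bounded_linear.has_vector_derivative[OF bounded_linear_scaleR_right]]) auto
  moreover have "v$1 *\<^sub>R (v$1 *\<^sub>R partial 1 (partial 1 Y) (x + 0 *\<^sub>R v) + v$2 *\<^sub>R partial 2 (partial 1 Y) (x + 0 *\<^sub>R v))
   + v$2 *\<^sub>R (v$1 *\<^sub>R partial 1 (partial 2 Y) (x + 0 *\<^sub>R v) + v$2 *\<^sub>R partial 2 (partial 2 Y) (x + 0 *\<^sub>R v)) = q"
    by (simp add: sym q_def vec_eq_iff power2_eq_square algebra_simps)
  ultimately have dp: "((\<lambda>\<tau>. P \<tau> $ i) has_real_derivative q $ i) (at 0)" for i
    by (intro vec_comp) simp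
  define u where "u \<tau> = helicoid_fun k \<phi> (Y (x + \<tau> *\<^sub>R v)) + t * ((Y (x + \<tau> *\<^sub>R v)$1)\<^sup>2 + (Y (x + \<tau> *\<^sub>R v)$2)\<^sup>2)" for \<tau>
  define u' where "u' \<tau> = P \<tau>$1 * sin (\<phi> + k * Y (x + \<tau> *\<^sub>R v)$3) - P \<tau>$2 * cos (\<phi> + k * Y (x + \<tau> *\<^sub>R v)$3)
      + k * P \<tau>$3 * (Y (x + \<tau> *\<^sub>R v)$1 * cos (\<phi> + k * Y (x + \<tau> *\<^sub>R v)$3) + Y (x + \<tau> *\<^sub>R v)$2 * sin (\<phi> + k * Y (x + \<tau> *\<^sub>R v)$3))
      + 2 * t * (Y (x + \<tau> *\<^sub>R v)$1 * P \<tau>$1 + Y (x + \<tau> *\<^sub>R v)$2 * P \<tau>$2)" for \<tau>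
  have P0: "P 0 = p" by (simp add: P_def p_def)
  have du: "(u has_real_derivative u' \<tau>) (at \<tau>)" if "\<bar>\<tau>\<bar> < d" for \<tau>
    unfolding u_def u'_def helicoid_fun_def
    by (rule derivative_eq_intros dy[OF that] refl)+ (simp add: algebra_simps)
  have ddu: "(u' has_real_derivative
     sym_form (2*t) (2*t) (- k\<^sup>2 * helicoid_fun k \<phi> (Y x)) (k * C) (k * S) p p + grad \<bullet> q) (at 0)"
    unfolding u'_def
    by (rule derivative_eq_intros dy dp refl | simp add: d)+
      (simp add: P0 sym_form_def grad_def inner_vec_def sum_3 C_def S_def helicoid_fun_def power2_eq_square algebra_simps)
  have mx: "u \<tau> \<le> u 0" if "\<bar>\<tau>\<bar> < d" for \<tau>
    using max[OF inU[OF that]] by (simp add: u_def)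
  have "u' 0 = grad \<bullet> p"
    by (simp add: u'_def P0 grad_def inner_vec_def sum_3 C_def S_def algebra_simps)
  with second_derivative_le_0_at_local_max[OF d du ddu mx]
  show "grad \<bullet> p = 0"
    "sym_form (2*t) (2*t) (- k\<^sup>2 * helicoid_fun k \<phi> (Y x)) (k * C) (k * S) p p + grad \<bullet> q \<le> 0"
    by simp_all
qed

section \<open>The maximum principle\<close>

lemma sym_form_combine:
  "sym_form m1 m2 m3 m13 m23 (\<alpha> *\<^sub>R a + \<beta> *\<^sub>R b) (\<alpha> *\<^sub>R a + \<beta> *\<^sub>R b)
   = \<alpha>\<^sup>2 * sym_form m1 m2 m3 m13 m23 a a + 2 * \<alpha> * \<beta> * sym_form m1 m2 m3 m13 m23 a b
     + \<beta>\<^sup>2 * sym_form m1 m2 m3 m13 m23 b b"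
  unfolding sym_form_def by (simp add: algebra_simps power2_eq_square)

lemma immersion_cross_nonzero:
  fixes Y :: "real^2 \<Rightarrow> real^3"
  assumes "Y differentiable_on U" "open U" "x \<in> U" and inj: "inj (frechet_derivative Y (at x))"
  shows "cross3 (partial 1 Y x) (partial 2 Y x) \<noteq> 0"
proof
  let ?a = "partial 1 Y x" and ?b = "partial 2 Y x"
  assume "cross3 ?a ?b = 0"
  have D: "frechet_derivative Y (at x) v = v$1 *\<^sub>R ?a + v$2 *\<^sub>R ?b" for v
    by (simp add: frechet_derivative_at[OF has_derivative_partials[OF assms(1-3)], symmetric])
  have "v = 0" if "v$1 *\<^sub>R ?a + v$2 *\<^sub>R ?b = 0" for v :: "real^2"
    using injD[OF inj, of v 0] that by (simp add: D)
  then have zero: "v = 0" if "v$1 *\<^sub>R ?a + v$2 *\<^sub>R ?b = 0" for v :: "real^2"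
    using that by blast
  then have ind: "\<alpha> = 0 \<and> \<beta> = 0" if "\<alpha> *\<^sub>R ?a + \<beta> *\<^sub>R ?b = 0" for \<alpha> \<beta>
    using that zero[of "vector [\<alpha>, \<beta>]"] by (auto simp: vec_eq_iff forall_2)
  from \<open>cross3 ?a ?b = 0\<close> consider "?a = 0" | "?b = 0" | c where "?b = c *\<^sub>R ?a"
    unfolding cross_eq_0 collinear_lemma by blast
  then show False
    using ind[of 1 0] ind[of 0 1] ind[of _ "-1"] by cases auto
qed

text \<open>The computation behind the maximum principle. For \<open>f - t g\<close> with \<open>g = R - x\<^sup>2 - y\<^sup>2\<close> at a point
  where it vanishes, the left-hand side is the squared length of the gradient times the trace of the
  Hessian over the plane orthogonal to the gradient. In the orthonormal frame formed by the ruling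
  direction, the horizontal direction orthogonal to it and the vertical, the gradient is
  \<open>(2 t m, - (1 + 2 t f), k m)\<close> with \<open>m = x C + y S\<close>; that all terms collect into one product of
  definite sign is what makes \<open>g\<close> the right divisor.\<close>

lemma gradient_trace_identity:
  fixes \<phi> k t x y A :: real
  defines "C \<equiv> cos \<phi>" and "S \<equiv> sin \<phi>"
  defines "grad \<equiv> vector [S + 2 * t * x, - C + 2 * t * y, k * (x * C + y * S)] :: real^3"
    and "f \<equiv> x * S - y * C"
  assumes f: "f = t * g"
  shows "(2 * t + 2 * t + (- k\<^sup>2 * f)) * (grad \<bullet> grad)
      - sym_form (2*t) (2*t) (- k\<^sup>2 * f) (k * C) (k * S) grad grad
    = t * (2 - k\<^sup>2 * g) * ((2 * t * (x * C + y * S))\<^sup>2 + (1 + 2 * t * f)\<^sup>2)"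
proof -
  have C2: "C\<^sup>2 = 1 - S\<^sup>2" by (simp add: C_def S_def cos_squared_eq)
  define m where "m = x * C + y * S"
  have n2: "(S + 2 * t * x)\<^sup>2 + (- C + 2 * t * y)\<^sup>2 = (2 * t * m)\<^sup>2 + (1 + 2 * t * f)\<^sup>2"
  proof -
    have "m\<^sup>2 + f\<^sup>2 = (x\<^sup>2 + y\<^sup>2) * (C\<^sup>2 + S\<^sup>2)"
      unfolding m_def f_def by (simp add: power2_eq_square algebra_simps)
    then have 1: "m\<^sup>2 + f\<^sup>2 = x\<^sup>2 + y\<^sup>2" by (simp add: C2)
    have "(S + 2 * t * x)\<^sup>2 + (- C + 2 * t * y)\<^sup>2 = (C\<^sup>2 + S\<^sup>2) + 4 * t * f + 4 * t\<^sup>2 * (x\<^sup>2 + y\<^sup>2)"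
      unfolding f_def by (simp add: power2_eq_square algebra_simps)
    also have "\<dots> = (2 * t * m)\<^sup>2 + (1 + 2 * t * f)\<^sup>2"
      unfolding 1[symmetric] C2 by (simp add: power2_eq_square algebra_simps)
    finally show ?thesis .
  qed
  have e1: "(S + 2 * t * x) * C + (- C + 2 * t * y) * S = 2 * t * m"
    unfolding m_def by (simp add: algebra_simps)
  define p q where "p = S + 2 * t * x" and "q = - C + 2 * t * y"
  have grad: "grad = vector [p, q, k * m]" by (simp add: grad_def p_def q_def m_def)
  have "(2 * t + 2 * t + (- k\<^sup>2 * f)) * (grad \<bullet> grad)
      - sym_form (2*t) (2*t) (- k\<^sup>2 * f) (k * C) (k * S) grad grad
    = (4 * t - k\<^sup>2 * f) * ((p\<^sup>2 + q\<^sup>2) + k\<^sup>2 * m\<^sup>2)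
      - (2 * t * (p\<^sup>2 + q\<^sup>2) - k\<^sup>2 * f * (k\<^sup>2 * m\<^sup>2) + 2 * k\<^sup>2 * m * (p * C + q * S))"
    unfolding sym_form_def grad by (simp add: inner_vec_def sum_3 power2_eq_square algebra_simps)
  also have "\<dots> = (2 * t - k\<^sup>2 * f) * ((2 * t * m)\<^sup>2 + (1 + 2 * t * f)\<^sup>2)"
    unfolding p_def q_def n2 e1 by (simp add: power2_eq_square algebra_simps)
  finally show ?thesis unfolding m_def[symmetric] f by (simp add: algebra_simps)
qed

lemma sym_form_scaleR: "sym_form a b c d e (s *\<^sub>R v) (s *\<^sub>R v) = s\<^sup>2 * sym_form a b c d e v v"
  by (simp add: sym_form_def power2_eq_square algebra_simps)

text \<open>The inequalities of the second derivative test are combined with the weights that turn the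
  Hessian in the parameters into the Laplacian of the surface (up to a positive factor):
  completing the square shows that direction \<open>(G, -F)\<close> with weight \<open>1\<close> and direction \<open>(0, 1)\<close> with
  weight \<open>E G - F\<^sup>2\<close> do this. The terms with second derivatives of \<open>Y\<close> sum up to \<open>grad \<bullet> L\<close>, which
  is zero since the gradient is normal and \<open>L \<bullet> n\<close> is a multiple of the mean curvature. What
  remains is the trace of \<open>gradient_trace_identity\<close>, which is positive.\<close>

lemma no_positive_maximum_on_minimal_surface:
  fixes Y :: "real^2 \<Rightarrow> real^3"
  assumes Y: "C_on 2 U Y" and U: "open U" and x: "x \<in> U"
    and inj: "inj (frechet_derivative Y (at x))"
    and H: "mean_curvature Y x = 0"
    and t: "t > 0" and ft: "helicoid_fun k \<phi> (Y x) = t * (R - (Y x$1)\<^sup>2 - (Y x$2)\<^sup>2)"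
    and R: "(Y x$1)\<^sup>2 + (Y x$2)\<^sup>2 < R" "k\<^sup>2 * R < 2"
    and max: "\<And>y. y \<in> U \<Longrightarrow> helicoid_fun k \<phi> (Y y) \<le> t * (R - (Y y$1)\<^sup>2 - (Y y$2)\<^sup>2)"
  shows False
proof -
  define a b where "a = partial 1 Y x" and "b = partial 2 Y x"
  define E F G where "E = a \<bullet> a" and "F = a \<bullet> b" and "G = b \<bullet> b"
  define n where "n = cross3 a b"
  define g where "g = R - (Y x$1)\<^sup>2 - (Y x$2)\<^sup>2"
  define L where "L = E *\<^sub>R partial 2 (partial 2 Y) x - (2 * F) *\<^sub>R partial 1 (partial 2 Y) x + G *\<^sub>R partial 1 (partial 1 Y) x"
  have n0: "n \<noteq> 0" unfolding n_def a_def b_def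
    using immersion_cross_nonzero[OF _ U x inj] Y by (simp add: numeral_2_eq_2)
  have nn: "n \<bullet> n = E * G - F\<^sup>2"
    using norm_cross[of a b] unfolding n_def E_def F_def G_def
    by (simp add: power2_norm_eq_inner)
  have nn0: "n \<bullet> n > 0" using n0 by simp
  have G0: "G > 0" using n0 unfolding G_def n_def by auto
  have Ln: "L \<bullet> n = 0"
  proof -
    have eq: "second_form Y x i j = (partial i (partial j Y) x \<bullet> n) / norm n" for i j
      by (simp add: second_form_def unit_normal_def sgn_div_norm n_def a_def b_def divide_inverse mult.commute)
    have "0 = (second_form Y x 1 1 * G - 2 * second_form Y x 1 2 * F + second_form Y x 2 2 * E)"
      using H nn nn0
      by (simp add: mean_curvature_def first_form_def E_def F_def G_def a_def b_def)
    also have "\<dots> = (L \<bullet> n) / norm n"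
      unfolding L_def eq using n0 by (simp add: field_simps inner_left_distrib inner_diff_left)
    finally show ?thesis using n0 by simp
  qed
  define C S where "C = cos (\<phi> + k * Y x$3)" and "S = sin (\<phi> + k * Y x$3)"
  define grad :: "real^3" where "grad = vector [S + 2 * t * Y x$1, - C + 2 * t * Y x$2, k * (Y x$1 * C + Y x$2 * S)]"
  define f where "f = helicoid_fun k \<phi> (Y x)"
  define B where "B = sym_form (2*t) (2*t) (- k\<^sup>2 * f) (k * C) (k * S)"
  have max': "helicoid_fun k \<phi> (Y y) + t * ((Y y$1)\<^sup>2 + (Y y$2)\<^sup>2)
        \<le> helicoid_fun k \<phi> (Y x) + t * ((Y x$1)\<^sup>2 + (Y x$2)\<^sup>2)" if "y \<in> U" for y
    using max[OF that] ft by (simp add: algebra_simps)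
  note var = helicoid_fun_second_variation_at_max[OF Y U x max', folded C_def S_def a_def b_def, folded grad_def f_def, folded B_def]
  have ga: "grad \<bullet> a = 0" using var(1)[of "vector [1,0]"] by simp
  have gb: "grad \<bullet> b = 0" using var(1)[of "vector [0,1]"] by simp
  obtain c where c: "grad = c *\<^sub>R n"
    using orthogonal_imp_multiple_of_cross[of a b grad] ga gb n0 n_def by blast
  have fg: "f = t * g" using ft by (simp add: f_def g_def)
  have f0: "f > 0" using fg t R by (simp add: g_def)
  have tr: "(2 * t + 2 * t + (- k\<^sup>2 * f)) * (grad \<bullet> grad) - B grad grad
    = t * (2 - k\<^sup>2 * g) * ((2 * t * (Y x$1 * C + Y x$2 * S))\<^sup>2 + (1 + 2 * t * f)\<^sup>2)"
    unfolding grad_def B_def C_def S_def f_def helicoid_fun_def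
    by (rule gradient_trace_identity) (use fg in \<open>simp add: f_def helicoid_fun_def\<close>)
  have "k\<^sup>2 * g \<le> k\<^sup>2 * R" by (intro mult_left_mono) (auto simp: g_def)
  then have "2 - k\<^sup>2 * g > 0" using R by simp
  moreover have "1 + 2 * t * f > 0" using t f0 by (simp add: add_pos_pos)
  ultimately have "t * (2 - k\<^sup>2 * g) * ((2 * t * (Y x$1 * C + Y x$2 * S))\<^sup>2 + (1 + 2 * t * f)\<^sup>2) > 0"
    using t by (intro mult_pos_pos add_nonneg_pos) auto
  then have "c\<^sup>2 * ((2 * t + 2 * t + (- k\<^sup>2 * f)) * (n \<bullet> n) - B n n) > 0"
    unfolding tr[symmetric] c B_def sym_form_scaleR by (simp add: algebra_simps power2_eq_square)
  then have pos: "(2 * t + 2 * t + (- k\<^sup>2 * f)) * (n \<bullet> n) - B n n > 0"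
    by (simp add: zero_less_mult_iff)
  have "G * (G * B a a - 2 * F * B a b + E * B b b + grad \<bullet> L)
     = (B (G *\<^sub>R a + (-F) *\<^sub>R b) (G *\<^sub>R a + (-F) *\<^sub>R b) + grad \<bullet> (G\<^sup>2 *\<^sub>R partial 1 (partial 1 Y) x
         + (2 * G * (-F)) *\<^sub>R partial 1 (partial 2 Y) x + (-F)\<^sup>2 *\<^sub>R partial 2 (partial 2 Y) x))
       + (n \<bullet> n) * (B (0 *\<^sub>R a + 1 *\<^sub>R b) (0 *\<^sub>R a + 1 *\<^sub>R b) + grad \<bullet> (0\<^sup>2 *\<^sub>R partial 1 (partial 1 Y) x
         + (2 * 0 * 1) *\<^sub>R partial 1 (partial 2 Y) x + 1\<^sup>2 *\<^sub>R partial 2 (partial 2 Y) x))"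
    unfolding B_def sym_form_combine L_def nn
    by (simp add: power2_eq_square algebra_simps)
  also have "\<dots> \<le> 0"
    using var(2)[of "vector [G, -F]"] var(2)[of "vector [0, 1]"] nn0
    by (intro add_nonpos_nonpos[OF _ mult_nonneg_nonpos]) simp_all
  finally have "G * B a a - 2 * F * B a b + E * B b b + grad \<bullet> L \<le> 0"
    using G0 by (simp add: mult_le_0_iff)
  moreover have "grad \<bullet> L = 0" using Ln by (simp add: c inner_commute)
  moreover have "G * B a a - 2 * F * B a b + E * B b b = (2 * t + 2 * t + (- k\<^sup>2 * f)) * (n \<bullet> n) - B n n"
    using tangential_trace[of b "2*t" "2*t" "- k\<^sup>2 * f" "k * C" "k * S" a]
    by (simp add: E_def F_def G_def B_def n_def)
  ultimately show False using pos by simp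
qed

section \<open>Sections of local homeomorphisms over rectangles\<close>

text \<open>The part of covering space theory that is used, for a total space that is an abstract topology:
  through every point over \<open>K\<close> there passes a continuous section of \<open>Q\<close> on \<open>K\<close>.\<close>

definition liftable :: "'a topology \<Rightarrow> ('a \<Rightarrow> 'b::topological_space) \<Rightarrow> 'b set \<Rightarrow> bool" where
  "liftable M Q K \<longleftrightarrow> (\<forall>a\<in>topspace M. Q a \<in> K \<longrightarrow>
     (\<exists>\<sigma>. continuous_map (top_of_set K) M \<sigma> \<and> (\<forall>y\<in>K. Q (\<sigma> y) = y) \<and> \<sigma> (Q a) = a))"

text \<open>A box with its four bounds as separate parameters, so that it can be subdivided in one coordinate
  at a time.\<close>

definition rectangle :: "real \<Rightarrow> real \<Rightarrow> real \<Rightarrow> real \<Rightarrow> (real^2) set" where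
  "rectangle a b c d = {y. a \<le> y$1 \<and> y$1 \<le> b \<and> c \<le> y$2 \<and> y$2 \<le> d}"

lemma rectangle_eq_cbox: "rectangle a b c d = cbox (vector [a, c]) (vector [b, d])"
  by (auto simp: rectangle_def mem_box_cart forall_2)

lemma closed_rectangle: "closed (rectangle a b c d)"
  by (simp add: rectangle_eq_cbox closed_cbox)

lemma connected_rectangle: "connected (rectangle a b c d)"
  by (simp add: rectangle_eq_cbox convex_connected)

lemma rectangle_subset_ball:
  assumes "y \<in> rectangle a b c d" "b - a < e / 2" "d - c < e / 2"
  shows "rectangle a b c d \<subseteq> ball y e"
proof
  fix z assume z: "z \<in> rectangle a b c d"
  have "norm (y - z) \<le> \<bar>(y - z)$1\<bar> + \<bar>(y - z)$2\<bar>"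
    using norm_le_l1_cart[of "y - z"] by (simp add: sum_2)
  also have "\<dots> < e" using assms z by (auto simp: rectangle_def)
  finally show "z \<in> ball y e" by (simp add: dist_norm)
qed

text \<open>With the compactness of \<open>M\<close> these assumptions make \<open>Q\<close> a proper local homeomorphism over \<open>D\<close>,
  hence a finite covering; what lies over the complement of \<open>D\<close>, such as the boundary of a surface,
  is only required to close up to a compact space.\<close>

locale local_homeomorphism_over =
  fixes M :: "'a topology" and Q :: "'a \<Rightarrow> real^2" and D :: "(real^2) set"
  assumes compact: "compact_space M" and Hausdorff: "Hausdorff_space M"
    and cont: "continuous_map M euclidean Q" and openD: "open D"
    and local_homeo: "\<And>a. a \<in> topspace M \<Longrightarrow> Q a \<in> D \<Longrightarrow>
      \<exists>V. openin M V \<and> a \<in> V \<and> inj_on Q V \<and> (\<forall>W. openin M W \<longrightarrow> W \<subseteq> V \<longrightarrow> open (Q ` W))"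
begin

text \<open>The points where two lifts agree form a set that is closed because \<open>M\<close> is Hausdorff, and open
  because \<open>Q\<close> is locally injective.\<close>

lemma lift_unique:
  assumes T: "connected_space T" and u: "continuous_map T M u" and v: "continuous_map T M v"
    and Q: "\<And>x. x \<in> topspace T \<Longrightarrow> Q (u x) = Q (v x) \<and> Q (u x) \<in> D"
    and x0: "x0 \<in> topspace T" "u x0 = v x0" and x: "x \<in> topspace T"
  shows "u x = v x"
proof -
  let ?S = "{x \<in> topspace T. u x = v x}"
  have "closedin T ?S" by (rule closedin_continuous_maps_eq[OF Hausdorff u v])
  moreover have "openin T ?S"
  proof (subst openin_subopen, intro ballI)
    fix s assume s: "s \<in> ?S"
    then have "u s \<in> topspace M" using continuous_map_image_subset_topspace[OF u] by blast
    then obtain V where V: "openin M V" "u s \<in> V" "inj_on Q V"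
      using local_homeo[of "u s"] Q s by blast
    let ?W = "{x \<in> topspace T. u x \<in> V} \<inter> {x \<in> topspace T. v x \<in> V}"
    have "openin T ?W"
      using u v V(1) by (intro openin_Int openin_continuous_map_preimage)
    moreover have "s \<in> ?W" using s V by auto
    moreover have "?W \<subseteq> ?S" using V(3) Q by (auto simp: inj_on_def)
    ultimately show "\<exists>W. openin T W \<and> s \<in> W \<and> W \<subseteq> ?S" by blast
  qed
  ultimately have "?S = {} \<or> ?S = topspace T"
    using T unfolding connected_space_clopen_in by blast
  then show ?thesis using x0 x by blast
qed

text \<open>Finitely many open sets on which \<open>Q\<close> is injective cover the compact fibre over \<open>y\<close>. By compactness
  of the rest of \<open>M\<close>, everything over a small enough ball lies in one of them, and each of them maps
  onto that ball. So the local inverses of \<open>Q\<close> are the required sections.\<close>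

lemma liftable_locally:
  assumes y: "y \<in> D"
  shows "\<exists>e>0. \<forall>K. K \<subseteq> ball y e \<longrightarrow> K \<subseteq> D \<and> liftable M Q K"
proof -
  let ?F = "{a \<in> topspace M. Q a \<in> {y}}"
  have "closedin M ?F" by (intro closedin_continuous_map_preimage[OF cont]) simp
  then have F: "compactin M ?F" using compact closedin_compact_space by blast
  have "\<forall>a\<in>?F. \<exists>V. openin M V \<and> a \<in> V \<and> inj_on Q V \<and> (\<forall>W. openin M W \<longrightarrow> W \<subseteq> V \<longrightarrow> open (Q ` W))"
    using local_homeo y by auto
  then obtain V where V: "\<And>a. a \<in> ?F \<Longrightarrow> openin M (V a) \<and> a \<in> V a \<and> inj_on Q (V a)
      \<and> (\<forall>W. openin M W \<longrightarrow> W \<subseteq> V a \<longrightarrow> open (Q ` W))"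
    by (metis (no_types))
  obtain \<V> where \<V>: "finite \<V>" "\<V> \<subseteq> V ` ?F" "?F \<subseteq> \<Union>\<V>"
    using compactinD[OF F, of "V ` ?F"] V by blast
  have op: "openin M (\<Union>\<V>)" using \<V> V by (intro openin_Union) auto
  let ?C = "topspace M - \<Union>\<V>"
  have "closedin M ?C" using op by blast
  then have "compactin M ?C" using compact closedin_compact_space by blast
  then have "compactin euclidean (Q ` ?C)" using cont image_compactin by blast
  then have clC: "closed (Q ` ?C)" by (simp add: compact_imp_closed)
  \<comment> \<open>The points whose fibre avoids \<open>?C\<close> and which lie in the image of every set of the cover.\<close>
  define N where "N = D \<inter> (- (Q ` ?C)) \<inter> (\<Inter>W\<in>\<V>. Q ` W)"
  have "open (Q ` W)" if "W \<in> \<V>" for W using that \<V>(2) V by blast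
  then have "open N" unfolding N_def using openD clC \<V>(1) by (intro open_Int open_INT) auto
  moreover have "y \<notin> Q ` ?C" using \<V>(3) by auto
  then have "y \<in> N"
  proof -
    have "y \<in> Q ` W" if W: "W \<in> \<V>" for W
    proof -
      obtain a where a: "a \<in> ?F" "W = V a" using W \<V>(2) by blast
      then have "a \<in> W" "Q a = y" using V[OF a(1)] by auto
      then show ?thesis by blast
    qed
    then show ?thesis using y \<open>y \<notin> Q ` ?C\<close> by (simp add: N_def)
  qed
  ultimately obtain e where e: "e > 0" "ball y e \<subseteq> N" using open_contains_ball by blast
  have N: "N \<subseteq> D" "N \<inter> Q ` ?C = {}" "\<And>W. W \<in> \<V> \<Longrightarrow> N \<subseteq> Q ` W" by (auto simp: N_def)
  have "liftable M Q K" if K: "K \<subseteq> ball y e" for K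
    unfolding liftable_def
  proof (intro ballI impI)
    fix a assume a: "a \<in> topspace M" "Q a \<in> K"
    then have "Q a \<in> N" using K e(2) by blast
    then have "a \<notin> ?C" using N(2) by blast
    then obtain W where W: "a \<in> W" "W \<in> \<V>" using a by blast
    then obtain c where c: "c \<in> ?F" "W = V c" using \<V>(2) by blast
    have inj: "inj_on Q W" and opW: "openin M W" and opn: "\<And>Z. openin M Z \<Longrightarrow> Z \<subseteq> W \<Longrightarrow> open (Q ` Z)"
      using V[OF c(1)] c(2) by auto
    have KW: "K \<subseteq> Q ` W" using K e(2) N(3)[OF W(2)] by (meson order_trans)
    let ?\<sigma> = "inv_into W Q"
    have in_W: "?\<sigma> z \<in> W" "Q (?\<sigma> z) = z" if "z \<in> K" for z
      using KW that by (auto simp: inv_into_into f_inv_into_f)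
    have "continuous_map (top_of_set K) M ?\<sigma>"
      unfolding continuous_map_def
    proof (intro conjI allI impI)
      show "?\<sigma> \<in> topspace (top_of_set K) \<rightarrow> topspace M"
        using in_W openin_subset[OF opW] by auto
      fix Z assume Z: "openin M Z"
      have "{z \<in> topspace (top_of_set K). ?\<sigma> z \<in> Z} = K \<inter> Q ` (Z \<inter> W)"
      proof (intro set_eqI iffI)
        fix z assume "z \<in> {z \<in> topspace (top_of_set K). ?\<sigma> z \<in> Z}"
        then have "z \<in> K" "?\<sigma> z \<in> Z \<inter> W" "z = Q (?\<sigma> z)" using in_W by auto
        then show "z \<in> K \<inter> Q ` (Z \<inter> W)" by blast
      next
        fix z assume "z \<in> K \<inter> Q ` (Z \<inter> W)"
        then show "z \<in> {z \<in> topspace (top_of_set K). ?\<sigma> z \<in> Z}" using inj by auto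
      qed
      moreover have "open (Q ` (Z \<inter> W))" using Z opW by (intro opn openin_Int) auto
      ultimately show "openin (top_of_set K) {z \<in> topspace (top_of_set K). ?\<sigma> z \<in> Z}"
        by (metis openin_open_Int)
    qed
    moreover have "?\<sigma> (Q a) = a" using W inj by simp
    ultimately show "\<exists>\<sigma>. continuous_map (top_of_set K) M \<sigma> \<and> (\<forall>y\<in>K. Q (\<sigma> y) = y) \<and> \<sigma> (Q a) = a"
      using in_W(2) by blast
  qed
  moreover have "K \<subseteq> D" if "K \<subseteq> ball y e" for K using that e(2) N(1) by (meson order_trans)
  ultimately show ?thesis using e(1) by blast
qed

text \<open>A section over one set is continued over the other from a common point; on the connected overlap
  the two agree by uniqueness, so they can be pasted.\<close>

lemma liftable_Un:
  assumes lift: "liftable M Q K" "liftable M Q L" and closed: "closed K" "closed L"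
    and conn: "connected (K \<inter> L)" "K \<inter> L \<noteq> {}" and D: "K \<union> L \<subseteq> D"
  shows "liftable M Q (K \<union> L)"
proof -
  have *: "\<exists>\<sigma>. continuous_map (top_of_set (K \<union> L)) M \<sigma> \<and> (\<forall>y\<in>K \<union> L. Q (\<sigma> y) = y) \<and> \<sigma> (Q a) = a"
    if lift: "liftable M Q K" "liftable M Q L" and closed: "closed K" "closed L"
    and conn: "connected (K \<inter> L)" "K \<inter> L \<noteq> {}" and D: "K \<union> L \<subseteq> D"
    and a: "a \<in> topspace M" "Q a \<in> K" for a K L
  proof -
    obtain \<sigma> where \<sigma>: "continuous_map (top_of_set K) M \<sigma>" "\<And>y. y \<in> K \<Longrightarrow> Q (\<sigma> y) = y" "\<sigma> (Q a) = a"
      using lift(1) a unfolding liftable_def by blast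
    obtain b where b: "b \<in> K" "b \<in> L" using conn by blast
    have "\<sigma> b \<in> topspace M" using \<sigma>(1) b by (auto simp: continuous_map_def)
    then obtain \<tau> where \<tau>: "continuous_map (top_of_set L) M \<tau>" "\<And>y. y \<in> L \<Longrightarrow> Q (\<tau> y) = y" "\<tau> b = \<sigma> b"
      using lift(2) b \<sigma>(2)[OF b(1)] unfolding liftable_def by metis
    have eq: "\<sigma> y = \<tau> y" if "y \<in> K \<inter> L" for y
    proof (rule lift_unique[of "top_of_set (K \<inter> L)" \<sigma> \<tau> b])
      show "connected_space (top_of_set (K \<inter> L))"
        using conn(1) by (simp add: connected_space_subtopology)
      show "continuous_map (top_of_set (K \<inter> L)) M \<sigma>" "continuous_map (top_of_set (K \<inter> L)) M \<tau>"
        using \<sigma>(1) \<tau>(1) by (auto intro: continuous_map_from_subtopology_mono)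
    qed (use \<sigma> \<tau> b D that in auto)
    let ?g = "\<lambda>y. if y \<in> K then \<sigma> y else \<tau> y"
    have "continuous_map (top_of_set (K \<union> L)) M ?g"
    proof (rule pasting_lemma_closed[where I = "{True, False}" and T = "\<lambda>i. if i then K else L" and f = "\<lambda>i. if i then \<sigma> else \<tau>"])
      show "closedin (top_of_set (K \<union> L)) (if i then K else L)" for i
        using closed by (auto intro: closed_subset)
      show "continuous_map (subtopology (top_of_set (K \<union> L)) (if i then K else L)) M (if i then \<sigma> else \<tau>)" for i
        using \<sigma>(1) \<tau>(1) by (auto simp: subtopology_subtopology Int_absorb1 Int_absorb2)
    qed (use eq in \<open>auto split: if_splits\<close>)
    moreover have "\<forall>y\<in>K \<union> L. Q (?g y) = y" using \<sigma>(2) \<tau>(2) by auto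
    moreover have "?g (Q a) = a" using \<sigma>(3) a by simp
    ultimately show ?thesis by blast
  qed
  show ?thesis
    unfolding liftable_def
  proof (intro ballI impI)
    fix a assume a: "a \<in> topspace M" "Q a \<in> K \<union> L"
    show "\<exists>\<sigma>. continuous_map (top_of_set (K \<union> L)) M \<sigma> \<and> (\<forall>y\<in>K \<union> L. Q (\<sigma> y) = y) \<and> \<sigma> (Q a) = a"
    proof (cases "Q a \<in> K")
      case True
      then show ?thesis using *[of K L a] assms a by blast
    next
      case False
      have "connected (L \<inter> K)" "L \<inter> K \<noteq> {}" using conn by (auto simp: Int_commute)
      moreover have "L \<union> K \<subseteq> D" using D by blast
      ultimately show ?thesis using *[of L K a] assms a False by (simp add: Un_commute)
    qed
  qed
qed

text \<open>Rectangles inside \<open>D\<close> are built from small ones, which are liftable by \<open>liftable_locally\<close>, by gluing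
  along common edges. Bisection (\<open>Bolzano\<close>) organises this in each coordinate: first vertically, to
  obtain a thin strip around each vertical line, and then horizontally.\<close>

lemma liftable_rectangle:
  assumes D: "rectangle a b c d \<subseteq> D" and ab: "a \<le> b" and cd: "c \<le> d"
  shows "liftable M Q (rectangle a b c d)"
proof -
  define G where "G a b c d \<longleftrightarrow> rectangle a b c d \<subseteq> D \<and> liftable M Q (rectangle a b c d)" for a b c d
  have hglue: "G a m c d \<Longrightarrow> G m b c d \<Longrightarrow> a \<le> m \<Longrightarrow> m \<le> b \<Longrightarrow> c \<le> d \<Longrightarrow> G a b c d" for a m b c d
  proof -
    assume *: "G a m c d" "G m b c d" "a \<le> m" "m \<le> b" "c \<le> d"
    have U: "rectangle a b c d = rectangle a m c d \<union> rectangle m b c d"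
      and I: "rectangle a m c d \<inter> rectangle m b c d = rectangle m m c d"
      using * by (auto simp: rectangle_def)
    have "vector [m, c] \<in> rectangle m m c d" using * by (simp add: rectangle_def)
    then have "liftable M Q (rectangle a b c d)" unfolding U
      using * by (intro liftable_Un closed_rectangle) (auto simp: G_def I connected_rectangle)
    then show "G a b c d" using * U by (simp add: G_def)
  qed
  have vglue: "G a b c m \<Longrightarrow> G a b m d \<Longrightarrow> c \<le> m \<Longrightarrow> m \<le> d \<Longrightarrow> a \<le> b \<Longrightarrow> G a b c d" for a m b c d
  proof -
    assume *: "G a b c m" "G a b m d" "c \<le> m" "m \<le> d" "a \<le> b"
    have U: "rectangle a b c d = rectangle a b c m \<union> rectangle a b m d"
      and I: "rectangle a b c m \<inter> rectangle a b m d = rectangle a b m m"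
      using * by (auto simp: rectangle_def)
    have "vector [a, m] \<in> rectangle a b m m" using * by (simp add: rectangle_def)
    then have "liftable M Q (rectangle a b c d)" unfolding U
      using * by (intro liftable_Un closed_rectangle) (auto simp: G_def I connected_rectangle)
    then show "G a b c d" using * U by (simp add: G_def)
  qed
  have strip: "\<exists>\<delta>>0. \<forall>a' b'. a' \<le> x \<and> x \<le> b' \<and> b' - a' < \<delta> \<longrightarrow> G a' b' c d"
    if x: "a \<le> x" "x \<le> b" for x
    using cd
  proof (induction rule: Bolzano)
    case (trans c m d)
    then obtain \<delta> \<epsilon> where *: "\<delta> > 0" "\<forall>a' b'. a' \<le> x \<and> x \<le> b' \<and> b' - a' < \<delta> \<longrightarrow> G a' b' c m"
      "\<epsilon> > 0" "\<forall>a' b'. a' \<le> x \<and> x \<le> b' \<and> b' - a' < \<epsilon> \<longrightarrow> G a' b' m d" by blast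
    have "G a' b' c d" if "a' \<le> x" "x \<le> b'" "b' - a' < min \<delta> \<epsilon>" for a' b'
    proof (rule vglue)
      show "G a' b' c m" using *(2) that by simp
      show "G a' b' m d" using *(4) that by simp
    qed (use trans that in auto)
    moreover have "min \<delta> \<epsilon> > 0" using * by simp
    ultimately show ?case by blast
  next
    case (local y)
    have "vector [x, y] \<in> D" using D x local by (auto simp: rectangle_def)
    then obtain e where e: "e > 0" "\<And>K. K \<subseteq> ball (vector [x, y]) e \<Longrightarrow> K \<subseteq> D \<and> liftable M Q K"
      using liftable_locally by blast
    have "G a' b' c' d'" if "a' \<le> x \<and> x \<le> b' \<and> b' - a' < e / 2" "c' \<le> y \<and> y \<le> d' \<and> d' - c' < e / 2"
      for a' b' c' d'
    proof -
      have "vector [x, y] \<in> rectangle a' b' c' d'" using that by (simp add: rectangle_def)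
      from e(2)[OF rectangle_subset_ball[OF this]] that show ?thesis by (simp add: G_def)
    qed
    then have "\<exists>\<delta>>0. \<forall>a' b'. a' \<le> x \<and> x \<le> b' \<and> b' - a' < \<delta> \<longrightarrow> G a' b' c' d'"
      if "c' \<le> y \<and> y \<le> d' \<and> d' - c' < e / 2" for c' d'
      using half_gt_zero[OF e(1)] that by blast
    then show ?case using half_gt_zero[OF e(1)] by blast
  qed
  have "G a b c d"
    using ab
  proof (induction rule: Bolzano)
    case (trans a m b)
    then show ?case using hglue[of a m c d b] cd by blast
  next
    case (local x)
    then show ?case using strip by blast
  qed
  then show ?thesis by (simp add: G_def)
qed

text \<open>Joining any two points of a fibre to another base point by a rectangle shows that all fibres over
  \<open>D\<close> have equally many points. The point \<open>p\<close> over the frontier is alone in its fibre, so by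
  compactness the fibres over points near \<open>Q p\<close> lie in the neighbourhood \<open>N\<close>. Two points of such a
  fibre lie in a compact connected set \<open>C\<close> over \<open>D\<close>; the section through one of them over a
  rectangle that contains \<open>Q ` C\<close> retraces \<open>C\<close> and therefore passes through the other.\<close>

lemma bij_betw_over_box:
  assumes D: "D = box l u"
    and p: "p \<in> topspace M" "Q p \<in> closure D" "Q p \<notin> D"
    and fibre: "\<And>a. a \<in> topspace M \<Longrightarrow> Q a = Q p \<Longrightarrow> a = p"
    and N: "openin M N" "p \<in> N" "\<exists>a\<in>N. Q a \<in> D"
    and joined: "\<And>a b. a \<in> N \<Longrightarrow> b \<in> N \<Longrightarrow> Q a \<in> D \<Longrightarrow> Q b \<in> D \<Longrightarrow>
      \<exists>C. compactin M C \<and> connectedin M C \<and> a \<in> C \<and> b \<in> C \<and> Q ` C \<subseteq> D"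
  shows "bij_betw Q {a \<in> topspace M. Q a \<in> D} D"
proof -
  have lift: "\<exists>\<sigma>. continuous_map (top_of_set (rectangle a1 b1 c1 d1)) M \<sigma> \<and>
      (\<forall>y\<in>rectangle a1 b1 c1 d1. Q (\<sigma> y) = y) \<and> \<sigma> (Q a) = a"
    if "a \<in> topspace M" "Q a \<in> rectangle a1 b1 c1 d1" "rectangle a1 b1 c1 d1 \<subseteq> D" for a a1 b1 c1 d1
  proof -
    have "a1 \<le> b1" "c1 \<le> d1" using that(2) unfolding rectangle_def by auto
    then have "liftable M Q (rectangle a1 b1 c1 d1)" using that(3) liftable_rectangle by simp
    then show ?thesis using that(1,2) unfolding liftable_def by blast
  qed
  \<comment> \<open>A compact subset of the open box keeps a positive distance from its sides, so a closed rectangle fits between.\<close>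
  have rect: "\<exists>a b c d. C \<subseteq> rectangle a b c d \<and> rectangle a b c d \<subseteq> D" if "Topological_Spaces.compact C" "C \<noteq> {}" "C \<subseteq> D" for C
  proof -
    have 1: "\<exists>s\<in>C. \<exists>t\<in>C. \<forall>y\<in>C. s$i \<le> y$i \<and> y$i \<le> t$i" for i
    proof -
      have "continuous_on C (\<lambda>y. y$i)" by (intro continuous_on_component continuous_on_id)
      then show ?thesis
        using continuous_attains_inf[OF that(1,2)] continuous_attains_sup[OF that(1,2)] by metis
    qed
    obtain s1 t1 s2 t2 where *: "s1 \<in> C" "t1 \<in> C" "s2 \<in> C" "t2 \<in> C"
      "\<forall>y\<in>C. s1$1 \<le> y$1 \<and> y$1 \<le> t1$1" "\<forall>y\<in>C. s2$2 \<le> y$2 \<and> y$2 \<le> t2$2"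
      using 1[of 1] 1[of 2] by blast
    have "C \<subseteq> rectangle (s1$1) (t1$1) (s2$2) (t2$2)" using * by (auto simp: rectangle_def)
    moreover have "rectangle (s1$1) (t1$1) (s2$2) (t2$2) \<subseteq> D"
    proof -
      have "s1 \<in> D" "t1 \<in> D" "s2 \<in> D" "t2 \<in> D" using * that(3) by auto
      then show ?thesis unfolding D rectangle_def by (force simp: mem_box_cart forall_2)
    qed
    ultimately show ?thesis by blast
  qed
  have in_M: "\<sigma> y \<in> topspace M" if "continuous_map (top_of_set K) M \<sigma>" "y \<in> K" for \<sigma> and K :: "(real^2) set" and y
    using continuous_map_image_subset_topspace[OF that(1)] that(2) by auto
  obtain a0 where a0: "a0 \<in> N" "Q a0 \<in> D" using N(3) by blast
  have a0M: "a0 \<in> topspace M" using a0 openin_subset[OF N(1)] by blast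
  have surj: "D \<subseteq> Q ` {a \<in> topspace M. Q a \<in> D}"
  proof
    fix z assume z: "z \<in> D"
    have "{Q a0, z} \<subseteq> D" "Topological_Spaces.compact {Q a0, z}" using a0(2) z by auto
    then obtain a1 b1 c1 d1 where K: "{Q a0, z} \<subseteq> rectangle a1 b1 c1 d1" "rectangle a1 b1 c1 d1 \<subseteq> D"
      using rect[of "{Q a0, z}"] by blast
    obtain \<sigma> where \<sigma>: "continuous_map (top_of_set (rectangle a1 b1 c1 d1)) M \<sigma>"
        "\<forall>y\<in>rectangle a1 b1 c1 d1. Q (\<sigma> y) = y"
      using lift[OF a0M _ K(2)] K(1) by blast
    then have "\<sigma> z \<in> topspace M" "Q (\<sigma> z) = z" using in_M[OF \<sigma>(1), of z] K(1) by auto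
    then show "z \<in> Q ` {a \<in> topspace M. Q a \<in> D}" using z by force
  qed
  have inj: "inj_on Q {a \<in> topspace M. Q a \<in> D}"
  proof (rule inj_onI, rule ccontr)
    fix a b assume ab: "a \<in> {a \<in> topspace M. Q a \<in> D}" "b \<in> {a \<in> topspace M. Q a \<in> D}" "Q a = Q b" "a \<noteq> b"
    \<comment> \<open>Two distinct points over \<open>Q a\<close> are moved to distinct points over a base point \<open>z\<close> so close to \<open>Q p\<close> that its fibre lies in \<open>N\<close>.\<close>
    let ?C = "topspace M - N"
    have "closedin M ?C" using N(1) by blast
    then have "compactin M ?C" using compact closedin_compact_space by blast
    then have "compactin euclidean (Q ` ?C)" using cont image_compactin by blast
    then have "closed (Q ` ?C)" by (simp add: compact_imp_closed)
    then have "open (- (Q ` ?C))" by blast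
    moreover have "Q p \<in> - (Q ` ?C)" using fibre N(2) by auto
    ultimately obtain z where z: "z \<in> D" "z \<in> - (Q ` ?C)"
      using p(2) closure_iff_nhds_not_empty[of "Q p" D] by blast
    have abM: "a \<in> topspace M" "b \<in> topspace M" and QaD: "Q a \<in> D" using ab by auto
    have "{Q a, z} \<subseteq> D" "Topological_Spaces.compact {Q a, z}" using QaD z(1) by auto
    then obtain a1 b1 c1 d1 where K1: "{Q a, z} \<subseteq> rectangle a1 b1 c1 d1" "rectangle a1 b1 c1 d1 \<subseteq> D"
      using rect[of "{Q a, z}"] by blast
    define K where "K = rectangle a1 b1 c1 d1"
    have K: "K \<subseteq> D" "connected K" "Q a \<in> K" "z \<in> K"
      using K1 connected_rectangle by (simp_all add: K_def)
    have liftK: "\<exists>\<sigma>. continuous_map (top_of_set K) M \<sigma> \<and> (\<forall>y\<in>K. Q (\<sigma> y) = y) \<and> \<sigma> (Q x) = x"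
      if "x \<in> topspace M" "Q x \<in> K" for x
      using lift[OF that(1)] that(2) K(1) unfolding K_def by blast
    obtain \<sigma> where \<sigma>: "continuous_map (top_of_set K) M \<sigma>" "\<forall>y\<in>K. Q (\<sigma> y) = y" "\<sigma> (Q a) = a"
      using liftK[OF abM(1) K(3)] by blast
    have QbK: "Q b \<in> K" using K(3) ab(3) by simp
    obtain \<tau> where \<tau>: "continuous_map (top_of_set K) M \<tau>" "\<forall>y\<in>K. Q (\<tau> y) = y" "\<tau> (Q b) = b"
      using liftK[OF abM(2) QbK] by (elim exE conjE) (rule that)
    have ne: "\<sigma> z \<noteq> \<tau> z"
    proof (rule notI)
      assume "\<sigma> z = \<tau> z"
      moreover have "connected_space (top_of_set K)" using K(2) by (simp add: connected_space_subtopology)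
      ultimately have "\<sigma> (Q a) = \<tau> (Q a)"
        using lift_unique[of "top_of_set K" \<sigma> \<tau> z "Q a"] \<sigma>(1,2) \<tau>(1,2) K by auto
      then show False using \<sigma>(3) \<tau>(3) ab(3,4) by simp
    qed
    have m: "\<sigma> z \<in> topspace M" "\<tau> z \<in> topspace M" and Qz: "Q (\<sigma> z) = z" "Q (\<tau> z) = z"
      using in_M \<sigma> \<tau> K by auto
    have "x \<in> N" if "x \<in> topspace M" "Q x = z" for x using z(2) that by blast
    then have "\<sigma> z \<in> N" "\<tau> z \<in> N" using m Qz by auto
    then obtain C where C: "compactin M C" "connectedin M C" "\<sigma> z \<in> C" "\<tau> z \<in> C" "Q ` C \<subseteq> D"
      using joined[of "\<sigma> z" "\<tau> z"] Qz z(1) by auto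
    have "compactin euclidean (Q ` C)" using C(1) cont image_compactin by blast
    then have "Topological_Spaces.compact (Q ` C)" by simp
    then obtain a1 b1 c1 d1 where L: "Q ` C \<subseteq> rectangle a1 b1 c1 d1" "rectangle a1 b1 c1 d1 \<subseteq> D"
      using rect[of "Q ` C"] C(3,5) by blast
    have QL: "Q x \<in> rectangle a1 b1 c1 d1" if "x \<in> C" for x using L(1) that by blast
    obtain \<rho> where \<rho>: "continuous_map (top_of_set (rectangle a1 b1 c1 d1)) M \<rho>"
      "\<forall>y\<in>rectangle a1 b1 c1 d1. Q (\<rho> y) = y" "\<rho> (Q (\<sigma> z)) = \<sigma> z"
      using lift[OF m(1) QL[OF C(3)] L(2)] by blast
    have CM: "C \<subseteq> topspace M" using C(1) compactin_subset_topspace by blast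
    have "id (\<tau> z) = (\<rho> \<circ> Q) (\<tau> z)"
    proof (rule lift_unique[of "subtopology M C" id "\<rho> \<circ> Q" "\<sigma> z"])
      show "connected_space (subtopology M C)" using C(2) by (simp add: connectedin_def)
      have "continuous_map (subtopology M C) (top_of_set (rectangle a1 b1 c1 d1)) Q"
        using continuous_map_from_subtopology[OF cont] QL by (simp add: continuous_map_in_subtopology image_subset_iff)
      then show "continuous_map (subtopology M C) M (\<rho> \<circ> Q)" using \<rho>(1) continuous_map_compose by blast
      show "continuous_map (subtopology M C) M id" by (simp add: continuous_map_from_subtopology)
      show "\<sigma> z \<in> topspace (subtopology M C)" "\<tau> z \<in> topspace (subtopology M C)" using C m by auto
      show "id (\<sigma> z) = (\<rho> \<circ> Q) (\<sigma> z)" using \<rho>(3) by simp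
      fix x assume "x \<in> topspace (subtopology M C)"
      then have "Q x \<in> rectangle a1 b1 c1 d1" using QL by simp
      then show "Q (id x) = Q ((\<rho> \<circ> Q) x) \<and> Q (id x) \<in> D" using \<rho>(2) L(2) by auto
    qed
    then show False using ne Qz \<rho>(3) by simp
  qed
  show ?thesis unfolding bij_betw_def using inj surj by blast
qed

end

section \<open>Surfaces with boundary and immersed minimal surfaces\<close>

lemma openin_surface_interior: "openin M (surface_interior M)"
proof (subst openin_subopen, intro ballI)
  fix p assume "p \<in> surface_interior M"
  then obtain U and V :: "(real^2) set" where *: "openin M U" "p \<in> U" "open V"
      "subtopology M U homeomorphic_space top_of_set V"
    unfolding surface_interior_def by blast
  then have "U \<subseteq> surface_interior M"
    using openin_subset unfolding surface_interior_def by blast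
  then show "\<exists>T. openin M T \<and> p \<in> T \<and> T \<subseteq> surface_interior M" using * by blast
qed

text \<open>In a half-disc chart the points off the edge are interior points of the surface. Every point
  of the half disc is joined to a fixed point off the edge by a segment which leaves the edge at once
  if it starts there. Hence any two interior points in \<open>N\<close> are joined through interior points.\<close>

lemma boundary_neighbourhood:
  assumes M: "surface_with_boundary M" and p: "p \<in> topspace M"
  obtains N where "openin M N" "p \<in> N" "N \<inter> surface_interior M \<noteq> {}"
    "\<And>a b. a \<in> N \<inter> surface_interior M \<Longrightarrow> b \<in> N \<inter> surface_interior M \<Longrightarrow>
      \<exists>C. compactin M C \<and> connectedin M C \<and> a \<in> C \<and> b \<in> C \<and> C \<subseteq> surface_interior M"
proof -
  let ?H = "{x::real^2. 0 \<le> x$2}"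
  obtain U V where UV: "openin M U" "p \<in> U" "openin (top_of_set ?H) V"
      "subtopology M U homeomorphic_space top_of_set V"
    using M p unfolding surface_with_boundary_def by blast
  obtain f g where fg: "homeomorphic_maps (subtopology M U) (top_of_set V) f g"
    using UV(4) unfolding homeomorphic_space_def by blast
  have UM: "U \<subseteq> topspace M" using UV(1) openin_subset by blast
  have tU: "topspace (subtopology M U) = U" using UM by auto
  have contf: "continuous_map (subtopology M U) (top_of_set V) f"
    and contg: "continuous_map (top_of_set V) (subtopology M U) g"
    and gf: "\<And>q. q \<in> U \<Longrightarrow> g (f q) = q" and fgx: "\<And>x. x \<in> V \<Longrightarrow> f (g x) = x"
    using fg UM unfolding homeomorphic_maps_def by auto
  have fV: "f q \<in> V" if "q \<in> U" for q
    using continuous_map_image_subset_topspace[OF contf] that tU by auto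
  have gU: "g x \<in> U" if "x \<in> V" for x
    using continuous_map_image_subset_topspace[OF contg] that tU by auto
  obtain T where T: "open T" "V = ?H \<inter> T" using UV(3) openin_open by blast
  define x0 where "x0 = f p"
  have x0: "x0 \<in> V" using fV UV(2) by (simp add: x0_def)
  then obtain e where e: "e > 0" "ball x0 e \<subseteq> T" using T open_contains_ball by blast
  have HV: "x \<in> V" if "x \<in> ball x0 e" "0 \<le> x$2" for x using that e T by blast
  have open_pre: "openin M {q \<in> U. f q \<in> S}" if "open S" for S
  proof -
    have "openin (subtopology M U) {q \<in> topspace (subtopology M U). f q \<in> V \<inter> S}"
      using that by (intro openin_continuous_map_preimage[OF contf]) auto
    moreover have "{q \<in> topspace (subtopology M U). f q \<in> V \<inter> S} = {q \<in> U. f q \<in> S}"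
      using tU fV by auto
    ultimately show ?thesis using UV(1) openin_trans_full by metis
  qed
  define N where "N = {q \<in> U. f q \<in> ball x0 e}"
  define P where "P = ball x0 e \<inter> {x. 0 < x$2}"
  have opP: "open P" unfolding P_def
    by (intro open_Int open_ball open_Collect_less continuous_on_component continuous_on_id continuous_on_const)
  have PV: "P \<subseteq> V" using HV unfolding P_def by auto
  have gP: "g x \<in> surface_interior M" if x: "x \<in> P" for x
  proof -
    let ?W = "{q \<in> U. f q \<in> P}"
    have "homeomorphic_maps (subtopology (subtopology M U) ?W) (subtopology (top_of_set V) P) f g"
      using PV gU fgx by (intro homeomorphic_maps_subtopologies_alt[OF fg]) auto
    moreover have "subtopology (subtopology M U) ?W = subtopology M ?W"
      by (simp add: subtopology_subtopology Int_absorb1 subset_iff)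
    moreover have "subtopology (top_of_set V) P = top_of_set P"
      using PV by (simp add: subtopology_subtopology Int_absorb1)
    ultimately have "subtopology M ?W homeomorphic_space top_of_set P"
      unfolding homeomorphic_space_def by metis
    moreover have "g x \<in> ?W" using x PV gU fgx by auto
    moreover have "g x \<in> topspace M" using x PV gU UM by blast
    ultimately show ?thesis
      unfolding surface_interior_def using open_pre[OF opP] opP by blast
  qed
  define m where "m = x0 + (e/2) *\<^sub>R axis 2 1"
  have m2: "m$2 > 0" using x0 T(2) e(1) by (simp add: m_def add_nonneg_pos)
  have mb: "m \<in> ball x0 e" using e(1) by (simp add: m_def dist_norm)
  have mP: "m \<in> P" using m2 mb by (simp add: P_def)
  have seg: "closed_segment x m \<subseteq> insert x P" if x: "x \<in> V" "x \<in> ball x0 e" for x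
  proof
    fix y assume y: "y \<in> closed_segment x m"
    then obtain u where u: "0 \<le> u" "u \<le> 1" "y = (1 - u) *\<^sub>R x + u *\<^sub>R m"
      unfolding closed_segment_def by auto
    have yb: "y \<in> ball x0 e"
      using y x mb by (meson closed_segment_subset convex_ball subsetD)
    show "y \<in> insert x P"
    proof (cases "u = 0")
      case True then show ?thesis using u by simp
    next
      case False
      have "x$2 \<ge> 0" using x T by auto
      then have "y$2 > 0" using u False m2 by (simp add: add_nonneg_pos)
      then show ?thesis using yb by (simp add: P_def)
    qed
  qed
  show ?thesis
  proof (rule that[of N])
    show "openin M N" unfolding N_def by (rule open_pre) simp
    show "p \<in> N" using UV(2) e(1) by (simp add: N_def x0_def)
    have "g m \<in> N" using mP mb PV gU fgx by (auto simp: N_def)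
    then show "N \<inter> surface_interior M \<noteq> {}" using gP[OF mP] by blast
    fix a b assume ab: "a \<in> N \<inter> surface_interior M" "b \<in> N \<inter> surface_interior M"
    have fab: "f a \<in> V" "f b \<in> V" "f a \<in> ball x0 e" "f b \<in> ball x0 e" and abU: "a \<in> U" "b \<in> U"
      using ab fV by (auto simp: N_def)
    define S where "S = closed_segment (f a) m \<union> closed_segment (f b) m"
    have S1: "S \<subseteq> insert (f a) (insert (f b) P)" using seg fab unfolding S_def by blast
    then have SV: "S \<subseteq> V" using fab PV by blast
    have conS: "connected S" unfolding S_def
      by (intro connected_Un connected_segment) auto
    have comS: "compact S" unfolding S_def by (intro compact_Un compact_segment)
    have contg': "continuous_map (top_of_set V) M g"
      using contg continuous_map_in_subtopology by blast
    show "\<exists>C. compactin M C \<and> connectedin M C \<and> a \<in> C \<and> b \<in> C \<and> C \<subseteq> surface_interior M"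
    proof (intro exI[of _ "g ` S"] conjI)
      show "compactin M (g ` S)"
        using comS SV by (intro image_compactin[OF _ contg']) (simp add: compactin_subtopology)
      show "connectedin M (g ` S)"
        using conS SV by (intro connectedin_continuous_map_image[OF contg']) (simp add: connectedin_subtopology)
      have "f a \<in> S" "f b \<in> S" by (auto simp: S_def)
      then show "a \<in> g ` S" "b \<in> g ` S" using gf[OF abU(1)] gf[OF abU(2)] by (metis imageI)+
      show "g ` S \<subseteq> surface_interior M"
        using S1 gP gf abU ab by auto
    qed
  qed
qed

text \<open>A map with injective derivative at a point is injective near it if the derivative is continuous
  there in operator norm; this continuity follows from that of the two partial derivatives.\<close>

lemma immersion_locally_injective:
  fixes Y :: "real^2 \<Rightarrow> real^'n"
  assumes Y: "C_on (Suc k) U Y" and U: "open U" and x: "x \<in> U"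
    and inj: "inj (frechet_derivative Y (at x))"
  obtains e where "e > 0" "ball x e \<subseteq> U" "inj_on Y (ball x e)"
proof -
  define Y' where "Y' y v = v$1 *\<^sub>R partial 1 Y y + v$2 *\<^sub>R partial 2 Y y" for y and v :: "real^2"
  have diff: "Y differentiable_on U" and cont: "continuous_on U (partial i Y)" for i
  proof -
    show "Y differentiable_on U" using Y by simp
    have "C_on k U (partial i Y)" using Y by simp
    then show "continuous_on U (partial i Y)"
      by (cases k) (auto intro: differentiable_imp_continuous_on)
  qed
  have D: "(Y has_derivative Y' y) (at y)" if "y \<in> U" for y
    unfolding Y'_def by (rule has_derivative_partials[OF diff U that])
  have "inj (Y' x)" using inj frechet_derivative_at[OF D[OF x]] by simp
  moreover have "linear (Y' x)" using D[OF x] has_derivative_linear by blast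
  ultimately obtain g' where g': "linear g'" "g' \<circ> Y' x = id"
    using linear_injective_left_inverse by blast
  have close: "\<exists>d>0. \<forall>y. dist x y < d \<longrightarrow> onorm (\<lambda>v. Y' y v - Y' x v) < e" if e: "e > 0" for e
  proof -
    have "\<exists>d>0. \<forall>y. dist y x < d \<longrightarrow> dist (partial i Y y) (partial i Y x) < e / 3" for i
    proof -
      have "isCont (partial i Y) x"
        using cont U x continuous_on_eq_continuous_at by blast
      moreover have "e / 3 > 0" using e by simp
      ultimately show ?thesis unfolding continuous_at_eps_delta by blast
    qed
    then obtain d1 d2 where d: "d1 > 0" "\<And>y. dist y x < d1 \<Longrightarrow> dist (partial 1 Y y) (partial 1 Y x) < e / 3"
       "d2 > 0" "\<And>y. dist y x < d2 \<Longrightarrow> dist (partial 2 Y y) (partial 2 Y x) < e / 3" by meson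
    have "onorm (\<lambda>v. Y' y v - Y' x v) < e" if y: "dist x y < min d1 d2" for y
    proof -
      have 12: "norm (partial 1 Y y - partial 1 Y x) < e/3" "norm (partial 2 Y y - partial 2 Y x) < e/3"
        using d(2)[of y] d(4)[of y] y by (simp_all add: dist_norm norm_minus_commute)
      have "onorm (\<lambda>v. Y' y v - Y' x v) \<le> 2 * e / 3"
      proof (rule onorm_bound)
        fix v :: "real^2"
        have "Y' y v - Y' x v = v$1 *\<^sub>R (partial 1 Y y - partial 1 Y x) + v$2 *\<^sub>R (partial 2 Y y - partial 2 Y x)"
          by (simp add: Y'_def algebra_simps)
        also have "norm \<dots> \<le> \<bar>v$1\<bar> * norm (partial 1 Y y - partial 1 Y x) + \<bar>v$2\<bar> * norm (partial 2 Y y - partial 2 Y x)"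
          by (metis norm_scaleR norm_triangle_ineq)
        also have "\<dots> \<le> norm v * (e/3) + norm v * (e/3)"
          using 12 component_le_norm_cart[of v] by (intro add_mono mult_mono) (auto intro: less_imp_le)
        finally show "norm (Y' y v - Y' x v) \<le> 2 * e / 3 * norm v" by simp
      qed (use e in simp)
      then show ?thesis using e by simp
    qed
    then show ?thesis using d(1,3) by (intro exI[of _ "min d1 d2"]) simp
  qed
  have "bounded_linear g'" using g'(1) linear_conv_bounded_linear by blast
  from has_derivative_locally_injective[OF x U this g'(2) D close] show ?thesis
    using that by blast
qed

lemma oriented_atlas_chart:
  assumes "oriented_atlas M A" "(U, \<psi>) \<in> A"
  shows "open U" "openin M (\<psi> ` U)" "homeomorphic_map (top_of_set U) (subtopology M (\<psi> ` U)) \<psi>"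
proof -
  have "\<forall>(U, \<psi>)\<in>A. open U \<and> openin M (\<psi> ` U) \<and>
        homeomorphic_map (top_of_set U) (subtopology M (\<psi> ` U)) \<psi>"
    using assms(1) unfolding oriented_atlas_def by (rule conjunct1)
  from bspec[OF this assms(2)]
  show "open U" "openin M (\<psi> ` U)" "homeomorphic_map (top_of_set U) (subtopology M (\<psi> ` U)) \<psi>" by simp_all
qed

lemma oriented_atlas_covers:
  assumes "oriented_atlas M A" "p \<in> surface_interior M"
  obtains U \<psi> x where "(U, \<psi>) \<in> A" "x \<in> U" "p = \<psi> x"
proof -
  have "(\<Union>(U, \<psi>)\<in>A. \<psi> ` U) = surface_interior M"
    using assms(1) unfolding oriented_atlas_def by (elim conjE)
  then have "p \<in> (\<Union>(U, \<psi>)\<in>A. \<psi> ` U)" using assms(2) by simp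
  then show thesis using that by auto
qed

lemma minimal_surface_chart:
  assumes "minimal_surface M A X" "(U, \<psi>) \<in> A" "x \<in> U"
  shows "C_on 2 U (X \<circ> \<psi>)" "inj (frechet_derivative (X \<circ> \<psi>) (at x))" "mean_curvature (X \<circ> \<psi>) x = 0"
proof -
  have "\<forall>(U, \<psi>)\<in>A. C_on 2 U (X \<circ> \<psi>) \<and> (\<forall>x\<in>U. inj (frechet_derivative (X \<circ> \<psi>) (at x)))"
    and "\<forall>(U, \<psi>)\<in>A. \<forall>x\<in>U. mean_curvature (X \<circ> \<psi>) x = 0"
    using assms(1) unfolding minimal_surface_def immersion_def by simp_all
  from this[THEN bspec, OF assms(2)] assms(3)
  show "C_on 2 U (X \<circ> \<psi>)" "inj (frechet_derivative (X \<circ> \<psi>) (at x))" "mean_curvature (X \<circ> \<psi>) x = 0"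
    by simp_all
qed

lemma minimal_surfaceD:
  assumes "minimal_surface M A X"
  shows "compact_space M" "Hausdorff_space M" "surface_with_boundary M" "oriented_atlas M A"
    "continuous_map M euclidean X"
  using assms unfolding minimal_surface_def surface_with_boundary_def immersion_def by simp_all

text \<open>The quotient of \<open>helicoid_fun k \<phi>\<close> by \<open>g = R - x\<^sup>2 - y\<^sup>2\<close> attains its maximum on the compact
  surface. If it is positive, it is attained at an interior point, against
  \<open>no_positive_maximum_on_minimal_surface\<close>. The constant \<open>R = 3/2 r\<^sup>2\<close> satisfies both of its
  constraints: \<open>g > 0\<close> on the cylinder, and \<open>k\<^sup>2 R \<le> 3/2 < 2\<close>.\<close>

lemma helicoid_fun_nonpos:
  assumes min: "minimal_surface M A X" and r: "r > 0" and k: "k\<^sup>2 * r\<^sup>2 \<le> 1"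
    and C: "X ` topspace M \<subseteq> solid_cylinder r h"
    and bd: "\<And>p. p \<in> surface_boundary M \<Longrightarrow> helicoid_fun k \<phi> (X p) \<le> 0"
    and p: "p \<in> topspace M"
  shows "helicoid_fun k \<phi> (X p) \<le> 0"
proof (rule ccontr)
  assume pos: "\<not> ?thesis"
  define R where "R = 3/2 * r\<^sup>2"
  define g where "g y = R - (y$1)\<^sup>2 - (y$2)\<^sup>2" for y :: "real^3"
  define G where "G y = helicoid_fun k \<phi> y / g y" for y
  have R: "(y$1)\<^sup>2 + (y$2)\<^sup>2 < R" if "y \<in> solid_cylinder r h" for y
  proof -
    have "0 < r\<^sup>2" using r by simp
    moreover have "(y$1)\<^sup>2 + (y$2)\<^sup>2 \<le> r\<^sup>2" using that by (simp add: solid_cylinder_def)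
    ultimately show ?thesis unfolding R_def by linarith
  qed
  then have g: "g y > 0" if "y \<in> solid_cylinder r h" for y using that by (simp add: g_def algebra_simps)
  have "continuous_on (solid_cylinder r h) G"
    unfolding G_def helicoid_fun_def g_def
    by (intro continuous_intros) (use g g_def in force)
  moreover have "continuous_map M (top_of_set (solid_cylinder r h)) X"
    using minimal_surfaceD(5)[OF min] C by (simp add: continuous_map_in_subtopology image_subset_iff)
  ultimately have "continuous_map M euclideanreal (G \<circ> X)"
    by (intro continuous_map_compose) auto
  then have "compactin euclideanreal ((G \<circ> X) ` topspace M)"
    using minimal_surfaceD(1)[OF min] image_compactin unfolding compact_space_def by blast
  then have comp: "compact ((G \<circ> X) ` topspace M)" by simp
  obtain q where q: "q \<in> topspace M" "\<And>a. a \<in> topspace M \<Longrightarrow> G (X a) \<le> G (X q)"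
  proof -
    have "(G \<circ> X) ` topspace M \<noteq> {}" using p by blast
    then show thesis
      using compact_attains_sup[OF comp] that by auto
  qed
  have inC: "X a \<in> solid_cylinder r h" if "a \<in> topspace M" for a using C that by blast
  have "G (X p) > 0" using pos g[OF inC[OF p]] by (simp add: G_def)
  then have t: "G (X q) > 0" using q(2)[OF p] by simp
  then have "helicoid_fun k \<phi> (X q) > 0" using g[OF inC[OF q(1)]] by (simp add: G_def zero_less_divide_iff)
  then have "q \<notin> surface_boundary M" using bd by fastforce
  then have "q \<in> surface_interior M" using q(1) by (simp add: surface_boundary_def)
  then obtain U \<psi> x where U\<psi>: "(U, \<psi>) \<in> A" and x: "x \<in> U" "q = \<psi> x"
    using oriented_atlas_covers[OF minimal_surfaceD(4)[OF min]] by metis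
  have U: "open U" and \<psi>U: "\<psi> ` U \<subseteq> topspace M"
    using oriented_atlas_chart[OF minimal_surfaceD(4)[OF min] U\<psi>] openin_subset by auto
  note Y = minimal_surface_chart[OF min U\<psi> x(1)]
  have le: "helicoid_fun k \<phi> (X a) \<le> G (X q) * g (X a)" if "a \<in> topspace M" for a
    using q(2)[OF that] g[OF inC[OF that]] by (simp add: G_def[of "X a"] divide_le_eq)
  show False
  proof (rule no_positive_maximum_on_minimal_surface[OF Y(1) U x(1) Y(2,3) t, where R = R and k = k and \<phi> = \<phi>])
    show "helicoid_fun k \<phi> ((X \<circ> \<psi>) x) = G (X q) * (R - ((X \<circ> \<psi>) x $ 1)\<^sup>2 - ((X \<circ> \<psi>) x $ 2)\<^sup>2)"
      using g[OF inC[OF q(1)]] by (simp add: G_def x(2) g_def)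
    show "((X \<circ> \<psi>) x $ 1)\<^sup>2 + ((X \<circ> \<psi>) x $ 2)\<^sup>2 < R" using R[OF inC[OF q(1)]] x(2) by simp
    show "k\<^sup>2 * R < 2" using k by (simp add: R_def)
    fix y assume "y \<in> U"
    then show "helicoid_fun k \<phi> ((X \<circ> \<psi>) y) \<le> G (X q) * (R - ((X \<circ> \<psi>) y $ 1)\<^sup>2 - ((X \<circ> \<psi>) y $ 2)\<^sup>2)"
      using le[of "\<psi> y"] \<psi>U by (auto simp: g_def)
  qed
qed

section \<open>Helices, diameters and the boundary curve\<close>

lemma cyl_pt_component [simp]:
  "cyl_pt s \<phi> z $ 1 = s * cos \<phi>" "cyl_pt s \<phi> z $ 2 = s * sin \<phi>" "cyl_pt s \<phi> z $ 3 = z"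
  by (simp_all add: cyl_pt_def)

lemma cyl_pt_eq_iff:
  "cyl_pt s \<phi> z = cyl_pt s' \<phi>' z' \<longleftrightarrow> s * cos \<phi> = s' * cos \<phi>' \<and> s * sin \<phi> = s' * sin \<phi>' \<and> z = z'"
  by (auto simp: vec_eq_iff forall_3)

lemma cyl_pt_add_pi: "cyl_pt s (\<phi> + pi) z = cyl_pt (- s) \<phi> z"
  by (simp add: cyl_pt_eq_iff)

lemma cyl_pt_rotate:
  assumes "cyl_pt s \<phi> z = cyl_pt s' \<phi>' z'"
  shows "cyl_pt s (\<phi> + \<alpha>) w = cyl_pt s' (\<phi>' + \<alpha>) w"
  using assms unfolding cyl_pt_eq_iff cos_add sin_add
  by (simp add: right_diff_distrib distrib_left mult.assoc[symmetric])

lemma disk_diameter_eq: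
  assumes "r > 0"
  shows "disk_diameter r z \<phi> = {cyl_pt s \<phi> z | s. \<bar>s\<bar> \<le> r}"
proof -
  have *: "(1 - u) *\<^sub>R cyl_pt r \<phi> z + u *\<^sub>R cyl_pt (- r) \<phi> z = cyl_pt ((1 - 2 * u) * r) \<phi> z" for u
    by (simp add: vec_eq_iff forall_3 algebra_simps)
  have seg: "disk_diameter r z \<phi> = {cyl_pt ((1 - 2 * u) * r) \<phi> z | u. 0 \<le> u \<and> u \<le> 1}"
    unfolding disk_diameter_def closed_segment_def cyl_pt_add_pi * by blast
  show ?thesis
  proof (intro subset_antisym subsetI)
    fix p assume "p \<in> disk_diameter r z \<phi>"
    then obtain u where u: "0 \<le> u" "u \<le> 1" "p = cyl_pt ((1 - 2 * u) * r) \<phi> z" unfolding seg by blast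
    have "\<bar>(1 - 2 * u) * r\<bar> \<le> 1 * r" unfolding abs_mult
      using u assms by (intro mult_mono) auto
    then show "p \<in> {cyl_pt s \<phi> z | s. \<bar>s\<bar> \<le> r}" using u(3) by auto
  next
    fix p assume "p \<in> {cyl_pt s \<phi> z | s. \<bar>s\<bar> \<le> r}"
    then obtain s where s: "\<bar>s\<bar> \<le> r" "p = cyl_pt s \<phi> z" by blast
    have "(1 - 2 * ((1 - s / r) / 2)) * r = s" using assms by (simp add: field_simps)
    then have "p = cyl_pt ((1 - 2 * ((1 - s / r) / 2)) * r) \<phi> z" using s(2) by simp
    moreover have "0 \<le> (1 - s / r) / 2" "(1 - s / r) / 2 \<le> 1" using s(1) assms by (auto simp: field_simps)
    ultimately show "p \<in> disk_diameter r z \<phi>" unfolding seg by blast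
  qed
qed

lemma rot_helix:
  assumes r: "r > 0" and \<gamma>: "\<And>t. t \<in> {0..1} \<Longrightarrow> \<gamma> t = cyl_pt r (\<alpha> + \<beta> * t) (c + d * t)"
  shows "rot \<gamma> = \<beta>"
proof -
  have norm: "(\<gamma> t$1)\<^sup>2 + (\<gamma> t$2)\<^sup>2 = r\<^sup>2" if "t \<in> {0..1}" for t
    unfolding \<gamma>[OF that] by (simp add: power_mult_distrib flip: distrib_left)
  have "polar_lift \<gamma> (\<lambda>t. \<alpha> + \<beta> * t)"
    unfolding polar_lift_def
  proof (intro conjI ballI)
    fix t :: real assume t: "t \<in> {0..1}"
    show "\<gamma> t = cyl_pt (sqrt ((\<gamma> t$1)\<^sup>2 + (\<gamma> t$2)\<^sup>2)) (\<alpha> + \<beta> * t) (\<gamma> t$3)"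
      unfolding norm[OF t] using r by (simp add: \<gamma>[OF t])
  qed (intro continuous_intros)
  from rot_eq[OF this] norm r show ?thesis by simp
qed

text \<open>The rotation angle determines the slope of a helix, and its two heights determine the vertical
  speed, so the initial point fixes the helix. The parameter \<open>s = \<plusminus>r\<close> tells at which end of the
  diameter it starts.\<close>

lemma helix_from_diameter:
  assumes r: "r > 0" and h: "h > 0" and helix: "helix r \<gamma>" and rot: "rot \<gamma> = \<theta>"
    and start: "pathstart \<gamma> = cyl_pt s \<phi>\<^sub>0 0" and s: "\<bar>s\<bar> = r" and finish: "pathfinish \<gamma> $ 3 = h"
  shows "path_image \<gamma> = {cyl_pt s (\<phi>\<^sub>0 + \<theta> * z / h) z | z. 0 \<le> z \<and> z \<le> h}"
    and "pathfinish \<gamma> = cyl_pt s (\<phi>\<^sub>0 + \<theta>) h"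
proof -
  obtain \<alpha> \<beta> c d where \<gamma>: "\<And>t. t \<in> {0..1} \<Longrightarrow> \<gamma> t = cyl_pt r (\<alpha> + \<beta> * t) (c + d * t)"
    using helix unfolding helix_def by blast
  have \<beta>: "\<beta> = \<theta>" using rot_helix[OF r \<gamma>] rot by simp
  have 0: "cyl_pt r \<alpha> c = cyl_pt s \<phi>\<^sub>0 0" using start \<gamma>[of 0] by (simp add: pathstart_def)
  then have c: "c = 0" by (simp add: cyl_pt_eq_iff)
  have d: "d = h" using finish \<gamma>[of 1] c by (simp add: pathfinish_def)
  have \<gamma>': "\<gamma> t = cyl_pt s (\<phi>\<^sub>0 + \<theta> * t) (h * t)" if "t \<in> {0..1}" for t
    using \<gamma>[OF that] cyl_pt_rotate[OF 0] by (simp add: \<beta> c d)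
  show "pathfinish \<gamma> = cyl_pt s (\<phi>\<^sub>0 + \<theta>) h" using \<gamma>'[of 1] by (simp add: pathfinish_def)
  show "path_image \<gamma> = {cyl_pt s (\<phi>\<^sub>0 + \<theta> * z / h) z | z. 0 \<le> z \<and> z \<le> h}"
  proof (intro subset_antisym subsetI)
    fix p assume "p \<in> path_image \<gamma>"
    then obtain t where t: "t \<in> {0..1}" "p = \<gamma> t" by (auto simp: path_image_def)
    have "p = cyl_pt s (\<phi>\<^sub>0 + \<theta> * (h * t) / h) (h * t)" using t \<gamma>' h by simp
    moreover have "0 \<le> h * t" "h * t \<le> h" using t(1) h by (auto simp: mult_left_le)
    ultimately show "p \<in> {cyl_pt s (\<phi>\<^sub>0 + \<theta> * z / h) z | z. 0 \<le> z \<and> z \<le> h}" by blast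
  next
    fix p assume "p \<in> {cyl_pt s (\<phi>\<^sub>0 + \<theta> * z / h) z | z. 0 \<le> z \<and> z \<le> h}"
    then obtain z where z: "0 \<le> z" "z \<le> h" "p = cyl_pt s (\<phi>\<^sub>0 + \<theta> * z / h) z" by blast
    have "z / h \<in> {0..1}" using z h by simp
    moreover from this have "p = \<gamma> (z / h)" using \<gamma>' z(3) h by simp
    ultimately show "p \<in> path_image \<gamma>" unfolding path_image_def by blast
  qed
qed

text \<open>The boundary curve is the edge of the helicoid, described in the coordinates \<open>s\<close> and \<open>z\<close>. The
  upper diameter is located by the end points of the helices rather than by \<open>\<phi>\<^sub>1\<close>, which equals
  \<open>\<phi>\<^sub>0 + \<theta>\<close> only up to multiples of \<open>\<pi>\<close>.\<close>

lemma boundary_curve_eq: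
  assumes r: "r > 0" and h: "h > 0"
    and d1: "d\<^sub>1 = disk_diameter r h \<phi>\<^sub>1" and d2: "d\<^sub>2 = disk_diameter r 0 \<phi>\<^sub>0"
    and dh: "double_helix r h d\<^sub>1 d\<^sub>2 h\<^sub>1 h\<^sub>2" and rot: "rot h\<^sub>1 = \<theta>" "rot h\<^sub>2 = \<theta>"
  shows "d\<^sub>1 \<union> d\<^sub>2 \<union> path_image h\<^sub>1 \<union> path_image h\<^sub>2
    = {cyl_pt s (\<phi>\<^sub>0 + \<theta> * z / h) z | s z. \<bar>s\<bar> \<le> r \<and> 0 \<le> z \<and> z \<le> h \<and> (\<bar>s\<bar> = r \<or> z = 0 \<or> z = h)}"
    (is "_ = ?E")
proof -
  have hel: "helix r h\<^sub>1" "helix r h\<^sub>2" and seg2: "d\<^sub>2 = closed_segment (pathstart h\<^sub>1) (pathstart h\<^sub>2)"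
    and seg1: "d\<^sub>1 = closed_segment (pathfinish h\<^sub>1) (pathfinish h\<^sub>2)"
    using dh unfolding double_helix_def by auto
  have "closed_segment (pathstart h\<^sub>1) (pathstart h\<^sub>2) = closed_segment (cyl_pt r \<phi>\<^sub>0 0) (cyl_pt (- r) \<phi>\<^sub>0 0)"
    using seg2 d2 unfolding disk_diameter_def cyl_pt_add_pi by simp
  then have "{pathstart h\<^sub>1, pathstart h\<^sub>2} = {cyl_pt r \<phi>\<^sub>0 0, cyl_pt (- r) \<phi>\<^sub>0 0}"
    by (rule closed_segment_eq[THEN iffD1])
  then obtain s where s: "\<bar>s\<bar> = r" and st: "pathstart h\<^sub>1 = cyl_pt s \<phi>\<^sub>0 0" "pathstart h\<^sub>2 = cyl_pt (- s) \<phi>\<^sub>0 0"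
    using r unfolding doubleton_eq_iff by (metis abs_minus abs_of_pos minus_minus)
  have "pathfinish h\<^sub>1 \<in> disk_diameter r h \<phi>\<^sub>1" "pathfinish h\<^sub>2 \<in> disk_diameter r h \<phi>\<^sub>1"
    using seg1 d1 by auto
  then have fi: "pathfinish h\<^sub>1 $ 3 = h" "pathfinish h\<^sub>2 $ 3 = h"
    unfolding disk_diameter_eq[OF r] by auto
  have s': "\<bar>- s\<bar> = r" using s by simp
  note 1 = helix_from_diameter[OF r h hel(1) rot(1) st(1) s fi(1)]
  note 2 = helix_from_diameter[OF r h hel(2) rot(2) st(2) s' fi(2)]
  have sr: "s = r \<or> s = - r" using s by auto
  have "closed_segment (cyl_pt s (\<phi>\<^sub>0 + \<theta>) h) (cyl_pt (- s) (\<phi>\<^sub>0 + \<theta>) h) = disk_diameter r h (\<phi>\<^sub>0 + \<theta>)"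
    using sr unfolding disk_diameter_def cyl_pt_add_pi by (auto simp: closed_segment_commute)
  then have e1: "d\<^sub>1 = {cyl_pt s (\<phi>\<^sub>0 + \<theta>) h | s. \<bar>s\<bar> \<le> r}"
    unfolding seg1 1(2) 2(2) disk_diameter_eq[OF r] .
  have e2: "d\<^sub>2 = {cyl_pt s \<phi>\<^sub>0 0 | s. \<bar>s\<bar> \<le> r}" unfolding d2 disk_diameter_eq[OF r] ..
  have e3: "path_image h\<^sub>1 \<union> path_image h\<^sub>2 = {cyl_pt s (\<phi>\<^sub>0 + \<theta> * z / h) z | s z. \<bar>s\<bar> = r \<and> 0 \<le> z \<and> z \<le> h}"
  proof -
    have "{cyl_pt s (\<phi>\<^sub>0 + \<theta> * z / h) z | s z. \<bar>s\<bar> = r \<and> 0 \<le> z \<and> z \<le> h}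
      = {cyl_pt s (\<phi>\<^sub>0 + \<theta> * z / h) z | z. 0 \<le> z \<and> z \<le> h} \<union> {cyl_pt (- s) (\<phi>\<^sub>0 + \<theta> * z / h) z | z. 0 \<le> z \<and> z \<le> h}"
    proof -
      have "\<bar>t\<bar> = r \<longleftrightarrow> t = s \<or> t = - s" for t using s by auto
      then show ?thesis by auto
    qed
    then show ?thesis unfolding 1(1) 2(1) by simp
  qed
  have "?E = {cyl_pt s (\<phi>\<^sub>0 + \<theta>) h | s. \<bar>s\<bar> \<le> r} \<union> {cyl_pt s \<phi>\<^sub>0 0 | s. \<bar>s\<bar> \<le> r}
     \<union> {cyl_pt s (\<phi>\<^sub>0 + \<theta> * z / h) z | s z. \<bar>s\<bar> = r \<and> 0 \<le> z \<and> z \<le> h}" (is "_ = ?A \<union> ?B \<union> ?C")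
  proof (intro subset_antisym subsetI)
    fix p assume "p \<in> ?E"
    then obtain s z where p: "p = cyl_pt s (\<phi>\<^sub>0 + \<theta> * z / h) z" "\<bar>s\<bar> \<le> r" "0 \<le> z" "z \<le> h" "\<bar>s\<bar> = r \<or> z = 0 \<or> z = h"
      by blast
    from p(5) consider "\<bar>s\<bar> = r" | "z = 0" | "z = h" by blast
    then show "p \<in> ?A \<union> ?B \<union> ?C"
    proof cases
      case 1 then have "p \<in> ?C" using p by blast
      then show ?thesis by blast
    next
      case 2 then have "p \<in> ?B" using p by auto
      then show ?thesis by blast
    next
      case 3 then have "p \<in> ?A" using p h by auto
      then show ?thesis by blast
    qed
  next
    have E: "cyl_pt s (\<phi>\<^sub>0 + \<theta> * z / h) z \<in> ?E"
      if "\<bar>s\<bar> \<le> r" "0 \<le> z" "z \<le> h" "\<bar>s\<bar> = r \<or> z = 0 \<or> z = h" for s z using that by blast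
    fix p assume "p \<in> ?A \<union> ?B \<union> ?C"
    then consider s where "p = cyl_pt s (\<phi>\<^sub>0 + \<theta>) h" "\<bar>s\<bar> \<le> r" | s where "p = cyl_pt s \<phi>\<^sub>0 0" "\<bar>s\<bar> \<le> r"
      | s z where "p = cyl_pt s (\<phi>\<^sub>0 + \<theta> * z / h) z" "\<bar>s\<bar> = r" "0 \<le> z" "z \<le> h" by blast
    then show "p \<in> ?E"
    proof cases
      case (1 s) then show ?thesis using E[of s h] h by simp
    next
      case (2 s) then show ?thesis using E[of s 0] h by simp
    next
      case (3 s z) then show ?thesis using E[of s z] by simp
    qed
  qed
  then show ?thesis using e1 e2 e3 by (simp add: Un_assoc)
qed

text \<open>On the helicoid, the signed distance from the axis along the ruling and the height are coordinates;
  \<open>\<rho>\<close> extends the former to all of space.\<close>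

lemma helicoid_chart:
  defines "\<rho> \<equiv> \<lambda>k \<phi> p. p$1 * cos (\<phi> + k * p$3) + p$2 * sin (\<phi> + k * p$3)"
  shows "helicoid_fun k \<phi> p = 0 \<Longrightarrow> p = cyl_pt (\<rho> k \<phi> p) (\<phi> + k * p$3) (p$3)"
    and "\<rho> k \<phi> (cyl_pt s (\<phi> + k * z) z) = s"
    and "helicoid_fun k \<phi> (cyl_pt s (\<phi> + k * z) z) = 0"
proof -
  let ?C = "cos (\<phi> + k * p$3)" and ?S = "sin (\<phi> + k * p$3)"
  show "\<rho> k \<phi> (cyl_pt s (\<phi> + k * z) z) = s"
    by (simp add: \<rho>_def mult.assoc flip: power2_eq_square distrib_left)
  show "helicoid_fun k \<phi> (cyl_pt s (\<phi> + k * z) z) = 0" by (simp add: helicoid_fun_def)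
  assume f: "helicoid_fun k \<phi> p = 0"
  have cs: "?C * ?C = 1 - ?S * ?S" by (metis cos_squared_eq power2_eq_square)
  have "\<rho> k \<phi> p * ?C = p$1 - ?S * helicoid_fun k \<phi> p" "\<rho> k \<phi> p * ?S = p$2 + ?C * helicoid_fun k \<phi> p"
    using cs unfolding \<rho>_def helicoid_fun_def by algebra+
  then show "p = cyl_pt (\<rho> k \<phi> p) (\<phi> + k * p$3) (p$3)" using f by (simp add: vec_eq_iff forall_3)
qed

section \<open>Uniqueness of the helicoid\<close>

text \<open>In the chart \<open>Q\<close> of the helicoid the surface is mapped to the closed rectangle \<open>R\<close> with interior
  \<open>D\<close>. Since the immersion factors through \<open>Q\<close>, its local injectivity is inherited by \<open>Q\<close>, and
  invariance of domain in the plane makes \<open>Q\<close> a local homeomorphism of the interior; in particular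
  interior points of the surface go to \<open>D\<close>, so that the boundary points are those over \<open>R - D\<close>.\<close>

lemma compact_surface_in_helicoid_eq_helicoid:
  assumes r: "r > 0" and h: "h > 0"
    and min: "minimal_surface M A X"
    and C: "X ` topspace M \<subseteq> solid_cylinder r h"
    and bd: "bij_betw X (surface_boundary M)
      {cyl_pt s (\<phi>\<^sub>0 + \<theta> * z / h) z | s z. \<bar>s\<bar> \<le> r \<and> 0 \<le> z \<and> z \<le> h \<and> (\<bar>s\<bar> = r \<or> z = 0 \<or> z = h)}"
    and zero: "\<And>p. p \<in> topspace M \<Longrightarrow> helicoid_fun (\<theta> / h) \<phi>\<^sub>0 (X p) = 0"
  shows "bij_betw X (topspace M) (helicoid r h \<phi>\<^sub>0 \<theta>)"
proof -
  define k where "k = \<theta> / h"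
  define \<Phi> where "\<Phi> y = cyl_pt (y$1) (\<phi>\<^sub>0 + k * y$2) (y$2)" for y :: "real^2"
  define P :: "real^3 \<Rightarrow> real^2" where
    "P p = vector [p$1 * cos (\<phi>\<^sub>0 + k * p$3) + p$2 * sin (\<phi>\<^sub>0 + k * p$3), p$3]" for p
  define Q where "Q = P \<circ> X"
  define D :: "(real^2) set" where "D = box (vector [- r, 0]) (vector [r, h])"
  define R :: "(real^2) set" where "R = cbox (vector [- r, 0]) (vector [r, h])"
  have P\<Phi>: "P (\<Phi> y) = y" for y
    using helicoid_chart(2)[of "y$1" \<phi>\<^sub>0 k "y$2"] by (simp add: P_def \<Phi>_def vec_eq_iff forall_2)
  have \<Phi>Q: "\<Phi> (Q p) = X p" if "p \<in> topspace M" for p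
    using helicoid_chart(1)[OF zero[OF that]] by (simp add: Q_def P_def \<Phi>_def k_def)
  have R_iff: "y \<in> R \<longleftrightarrow> \<bar>y$1\<bar> \<le> r \<and> 0 \<le> y$2 \<and> y$2 \<le> h" for y
    unfolding R_def by (auto simp: mem_box_cart forall_2)
  have D_iff: "y \<in> D \<longleftrightarrow> \<bar>y$1\<bar> < r \<and> 0 < y$2 \<and> y$2 < h" for y
    unfolding D_def by (auto simp: mem_box_cart forall_2)
  have DR: "D = interior R" unfolding D_def R_def by simp
  have D0: "D \<noteq> {}"
  proof -
    have "vector [0, h/2] \<in> D" using r h by (simp add: D_iff)
    then show ?thesis by blast
  qed
  have clD: "closure D = R" using D0 unfolding D_def R_def by simp
  have edge: "{cyl_pt s (\<phi>\<^sub>0 + \<theta> * z / h) z | s z. \<bar>s\<bar> \<le> r \<and> 0 \<le> z \<and> z \<le> h \<and> (\<bar>s\<bar> = r \<or> z = 0 \<or> z = h)} = \<Phi> ` (R - D)"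
  proof -
    have "(\<bar>s\<bar> \<le> r \<and> 0 \<le> z \<and> z \<le> h \<and> (\<bar>s\<bar> = r \<or> z = 0 \<or> z = h)) \<longleftrightarrow> vector [s, z] \<in> R - D" for s z
      by (auto simp: R_iff D_iff)
    moreover have "cyl_pt s (\<phi>\<^sub>0 + \<theta> * z / h) z = \<Phi> (vector [s, z])" for s z by (simp add: \<Phi>_def k_def)
    moreover have "\<exists>s z. y = vector [s, z]" for y :: "real^2"
      by (rule exI[of _ "y$1"], rule exI[of _ "y$2"]) (simp add: vec_eq_iff forall_2)
    ultimately show ?thesis unfolding image_def by (auto; metis)
  qed
  have hel: "helicoid r h \<phi>\<^sub>0 \<theta> = \<Phi> ` R"
  proof -
    have "(\<bar>s\<bar> \<le> r \<and> 0 \<le> z \<and> z \<le> h) \<longleftrightarrow> vector [s, z] \<in> R" for s z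
      by (auto simp: R_iff)
    moreover have "cyl_pt s (\<phi>\<^sub>0 + \<theta> * z / h) z = \<Phi> (vector [s, z])" for s z by (simp add: \<Phi>_def k_def)
    moreover have "\<exists>s z. y = vector [s, z]" for y :: "real^2"
      by (rule exI[of _ "y$1"], rule exI[of _ "y$2"]) (simp add: vec_eq_iff forall_2)
    ultimately show ?thesis unfolding image_def helicoid_def by (auto; metis)
  qed
  have QR: "Q p \<in> R" if "p \<in> topspace M" for p
  proof -
    have "X p \<in> solid_cylinder r h" using C that by blast
    moreover have "X p $ 1 = Q p $ 1 * cos (\<phi>\<^sub>0 + k * Q p $ 2)" "X p $ 2 = Q p $ 1 * sin (\<phi>\<^sub>0 + k * Q p $ 2)" "X p $ 3 = Q p $ 2"
      using \<Phi>Q[OF that] unfolding \<Phi>_def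
    by (metis cyl_pt_component(1), metis cyl_pt_component(2), metis cyl_pt_component(3))
    ultimately have "(Q p $ 1)\<^sup>2 \<le> r\<^sup>2" "0 \<le> Q p $ 2" "Q p $ 2 \<le> h"
      by (auto simp: solid_cylinder_def power_mult_distrib simp flip: distrib_left)
    then show ?thesis using r by (simp add: R_iff abs_le_square_iff[symmetric])
  qed
  note compM = minimal_surfaceD(1)[OF min] and HM = minimal_surfaceD(2)[OF min]
    and swb = minimal_surfaceD(3)[OF min] and atlas = minimal_surfaceD(4)[OF min]
    and contX = minimal_surfaceD(5)[OF min]
  have contP: "continuous_on UNIV P"
  proof -
    have "P = (\<lambda>p. (p$1 * cos (\<phi>\<^sub>0 + k * p$3) + p$2 * sin (\<phi>\<^sub>0 + k * p$3)) *\<^sub>R axis 1 1 + p$3 *\<^sub>R axis 2 1)"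
      by (simp add: fun_eq_iff P_def vec_eq_iff forall_2 axis_def)
    then show ?thesis by (simp only:) (intro continuous_intros)
  qed
  have contQ: "continuous_map M euclidean Q"
    unfolding Q_def by (rule continuous_map_compose[OF contX]) (simp add: contP)
  have bdQ: "Q p \<in> R - D" if "p \<in> surface_boundary M" for p
  proof -
    have "X p \<in> \<Phi> ` (R - D)" using bd that unfolding edge bij_betw_def by blast
    then show ?thesis using P\<Phi> by (auto simp: Q_def)
  qed
  have local: "\<exists>V. openin M V \<and> a \<in> V \<and> inj_on Q V \<and> (\<forall>W. openin M W \<longrightarrow> W \<subseteq> V \<longrightarrow> open (Q ` W))"
    if a: "a \<in> surface_interior M" for a
  proof -
    obtain U \<psi> x where U\<psi>: "(U, \<psi>) \<in> A" and x: "x \<in> U" "a = \<psi> x"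
      using oriented_atlas_covers[OF atlas a] by metis
    note U = oriented_atlas_chart(1)[OF atlas U\<psi>] and op\<psi>U = oriented_atlas_chart(2)[OF atlas U\<psi>]
      and hom = oriented_atlas_chart(3)[OF atlas U\<psi>]
    note Y = minimal_surface_chart(1,2)[OF min U\<psi> x(1), unfolded numeral_2_eq_2]
    obtain e where e: "e > 0" "ball x e \<subseteq> U" "inj_on (X \<circ> \<psi>) (ball x e)"
      using immersion_locally_injective[OF Y(1) U x(1) Y(2)] by blast
    have \<psi>M: "\<psi> y \<in> topspace M" if "y \<in> U" for y using openin_subset[OF op\<psi>U] that by blast
    have op: "openin M (\<psi> ` S)" if "open S" "S \<subseteq> U" for S
    proof -
      have "openin (top_of_set U) S" using that by (simp add: open_subset)
      then have "openin (subtopology M (\<psi> ` U)) (\<psi> ` S)"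
        using homeomorphic_imp_open_map[OF hom] unfolding open_map_def by blast
      then show ?thesis using op\<psi>U openin_trans_full by blast
    qed
    have pre: "open {y \<in> ball x e. \<psi> y \<in> W}" if "openin M W" for W
    proof -
      have "continuous_map (top_of_set U) M \<psi>"
        using homeomorphic_imp_continuous_map[OF hom] continuous_map_in_subtopology by blast
      then have "openin (top_of_set U) {y \<in> topspace (top_of_set U). \<psi> y \<in> W}"
        using that openin_continuous_map_preimage by blast
      then have "open {y \<in> U. \<psi> y \<in> W}" using U by (simp add: openin_open_eq)
      then have "open (ball x e \<inter> {y \<in> U. \<psi> y \<in> W})" by blast
      moreover have "ball x e \<inter> {y \<in> U. \<psi> y \<in> W} = {y \<in> ball x e. \<psi> y \<in> W}" using e(2) by blast
      ultimately show ?thesis by simp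
    qed
    have injQ: "inj_on (Q \<circ> \<psi>) (ball x e)"
    proof (rule inj_onI)
      fix y y' assume *: "y \<in> ball x e" "y' \<in> ball x e" "(Q \<circ> \<psi>) y = (Q \<circ> \<psi>) y'"
      then have "X (\<psi> y) = X (\<psi> y')" using \<Phi>Q[OF \<psi>M] e(2) by (metis comp_apply subsetD)
      then show "y = y'" using e(3) * by (simp add: inj_on_def)
    qed
    have contQ\<psi>: "continuous_on U (Q \<circ> \<psi>)"
    proof -
      have "continuous_map (top_of_set U) M \<psi>"
        using homeomorphic_imp_continuous_map[OF hom] continuous_map_in_subtopology by blast
      then show ?thesis using continuous_map_compose[OF _ contQ] by fastforce
    qed
    show ?thesis
    proof (intro exI[of _ "\<psi> ` ball x e"] conjI allI impI)
      show "openin M (\<psi> ` ball x e)" using op e(2) by simp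
      show "a \<in> \<psi> ` ball x e" using x(2) e(1) by simp
      show "inj_on Q (\<psi> ` ball x e)" using injQ by (rule inj_on_imageI)
      fix W assume W: "openin M W" "W \<subseteq> \<psi> ` ball x e"
      let ?S = "{y \<in> ball x e. \<psi> y \<in> W}"
      have S: "?S \<subseteq> ball x e" "?S \<subseteq> U" using e(2) by auto
      have "open ((Q \<circ> \<psi>) ` ?S)"
        using continuous_on_subset[OF contQ\<psi> S(2)] pre[OF W(1)] inj_on_subset[OF injQ S(1)]
        by (rule invariance_of_domain)
      moreover have "(Q \<circ> \<psi>) ` ?S = Q ` W"
      proof -
        have "\<psi> ` ?S = W" using W(2) by blast
        then show ?thesis by (metis image_comp)
      qed
      ultimately show "open (Q ` W)" by simp
    qed
  qed
  have intQ: "Q p \<in> D" if p: "p \<in> surface_interior M" for p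
  proof -
    obtain V where V: "openin M V" "p \<in> V" "open (Q ` V)" using local[OF p] by blast
    have "Q ` V \<subseteq> R" using QR openin_subset[OF V(1)] by blast
    then show ?thesis unfolding DR using V by (meson imageI interiorI)
  qed
  have int_eq: "{p \<in> topspace M. Q p \<in> D} = surface_interior M"
    using intQ bdQ unfolding surface_boundary_def surface_interior_def by blast
  have top_eq: "topspace M = surface_interior M \<union> surface_boundary M"
    unfolding surface_boundary_def surface_interior_def by blast
  have sheet: "bij_betw Q (surface_interior M) D"
  proof -
    interpret local_homeomorphism_over M Q D
      using compM HM contQ local int_eq by unfold_locales (auto simp: D_def)
    have "vector [r, 0] \<in> R - D" using r h by (simp add: R_iff D_iff)
    then obtain p where p: "p \<in> surface_boundary M" using bd unfolding edge bij_betw_def by blast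
    have pM: "p \<in> topspace M" using p top_eq by blast
    obtain N where N: "openin M N" "p \<in> N" "N \<inter> surface_interior M \<noteq> {}"
      "\<And>a b. a \<in> N \<inter> surface_interior M \<Longrightarrow> b \<in> N \<inter> surface_interior M \<Longrightarrow>
      \<exists>C. compactin M C \<and> connectedin M C \<and> a \<in> C \<and> b \<in> C \<and> C \<subseteq> surface_interior M"
      using boundary_neighbourhood[OF swb pM] by blast
    have "bij_betw Q {a \<in> topspace M. Q a \<in> D} D"
    proof (rule bij_betw_over_box[OF D_def pM _ _ _ N(1,2)])
      show "Q p \<in> closure D" "Q p \<notin> D" using bdQ[OF p] clD by auto
      show "a = p" if a: "a \<in> topspace M" "Q a = Q p" for a
      proof -
        have "a \<in> surface_boundary M" using a bdQ[OF p] intQ[of a] top_eq by auto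
        moreover have "X a = X p" using \<Phi>Q a pM by metis
        ultimately show ?thesis using bd p unfolding bij_betw_def inj_on_def by blast
      qed
      show "\<exists>a\<in>N. Q a \<in> D" using N(3) intQ by blast
      fix a b assume ab: "a \<in> N" "b \<in> N" "Q a \<in> D" "Q b \<in> D"
      have "a \<in> N \<inter> surface_interior M" "b \<in> N \<inter> surface_interior M"
        using ab openin_subset[OF N(1)] int_eq by auto
      from N(4)[OF this] show "\<exists>C. compactin M C \<and> connectedin M C \<and> a \<in> C \<and> b \<in> C \<and> Q ` C \<subseteq> D"
        using intQ by blast
    qed
    then show ?thesis unfolding int_eq .
  qed
  have bdX: "X ` surface_boundary M = \<Phi> ` (R - D)" "inj_on X (surface_boundary M)"
    using bd unfolding edge bij_betw_def by auto
  have "Q ` surface_boundary M = R - D"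
  proof -
    have "P ` X ` surface_boundary M = P ` \<Phi> ` (R - D)" using bdX(1) by simp
    then show ?thesis by (simp add: Q_def image_image P\<Phi>)
  qed
  moreover have "inj_on Q (surface_boundary M)"
  proof (rule inj_onI)
    fix a b assume *: "a \<in> surface_boundary M" "b \<in> surface_boundary M" "Q a = Q b"
    then have "X a = X b" using \<Phi>Q top_eq by (metis UnCI)
    then show "a = b" using bdX(2) * by (simp add: inj_on_def)
  qed
  ultimately have "bij_betw Q (surface_boundary M) (R - D)" unfolding bij_betw_def by blast
  from bij_betw_combine[OF sheet this] have "bij_betw Q (topspace M) (D \<union> (R - D))"
    unfolding top_eq by blast
  moreover have "D \<union> (R - D) = R" unfolding DR using interior_subset by blast
  ultimately have bQ: "bij_betw Q (topspace M) R" by simp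
  have "inj_on \<Phi> R" using P\<Phi> by (metis inj_on_inverseI)
  then have "bij_betw \<Phi> R (\<Phi> ` R)" by (rule inj_on_imp_bij_betw)
  from bij_betw_trans[OF bQ this] have "bij_betw (\<Phi> \<circ> Q) (topspace M) (helicoid r h \<phi>\<^sub>0 \<theta>)"
    unfolding hel .
  then show ?thesis using bij_betw_cong[of "topspace M" "\<Phi> \<circ> Q" X] \<Phi>Q by simp
qed

theorem theorem2p4:
  fixes r h \<theta> \<phi>\<^sub>0 \<phi>\<^sub>1 :: real
    and d\<^sub>1 d\<^sub>2 :: "(real^3) set"
    and h\<^sub>1 h\<^sub>2 :: "real \<Rightarrow> real^3"
    and M :: "'a topology"
    and A :: "((real^2) set \<times> (real^2 \<Rightarrow> 'a)) set"
    and X :: "'a \<Rightarrow> real^3"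
  assumes "r > 0" and "h > 0"
    and "d\<^sub>1 = disk_diameter r h \<phi>\<^sub>1" and "d\<^sub>2 = disk_diameter r 0 \<phi>\<^sub>0"
    and "double_helix r h d\<^sub>1 d\<^sub>2 h\<^sub>1 h\<^sub>2"
    and "rot h\<^sub>1 = \<theta>" and "rot h\<^sub>2 = \<theta>"
    and "minimal_surface M A X"
    and "X ` topspace M \<subseteq> solid_cylinder r h"
    and "spans M X (d\<^sub>1 \<union> d\<^sub>2 \<union> path_image h\<^sub>1 \<union> path_image h\<^sub>2)"
    and "0 \<le> \<theta>" and "\<theta> \<le> h / r"
  shows "bij_betw X (topspace M) (helicoid r h \<phi>\<^sub>0 \<theta>)"
proof -
  define k where "k = \<theta> / h"
  let ?E = "{cyl_pt s (\<phi>\<^sub>0 + \<theta> * z / h) z | s z. \<bar>s\<bar> \<le> r \<and> 0 \<le> z \<and> z \<le> h \<and> (\<bar>s\<bar> = r \<or> z = 0 \<or> z = h)}"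
  have bd: "bij_betw X (surface_boundary M) ?E"
    using assms(10) boundary_curve_eq[OF assms(1-7)] unfolding spans_def by simp
  have "0 \<le> k * r" "k * r \<le> 1" using assms by (auto simp: k_def field_simps)
  then have kr: "k\<^sup>2 * r\<^sup>2 \<le> 1" using power_le_one[of "k * r" 2] by (simp add: power_mult_distrib)
  have zero_bd: "helicoid_fun k \<phi>\<^sub>0 (X p) = 0" if "p \<in> surface_boundary M" for p
  proof -
    have "X p \<in> ?E" using bd that unfolding bij_betw_def by blast
    then obtain s z where "X p = cyl_pt s (\<phi>\<^sub>0 + k * z) z" by (auto simp: k_def)
    then show ?thesis using helicoid_chart(3) by simp
  qed
  \<comment> \<open>A half turn of the helicoid about its axis exchanges the two sides, so one bound gives both.\<close>
  have flip: "helicoid_fun k (\<phi>\<^sub>0 + pi) y = - helicoid_fun k \<phi>\<^sub>0 y" for y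
  proof -
    have "\<phi>\<^sub>0 + pi + k * y$3 = (\<phi>\<^sub>0 + k * y$3) + pi" by simp
    then show ?thesis unfolding helicoid_fun_def by (simp only: sin_periodic_pi cos_periodic_pi)
  qed
  have "helicoid_fun k \<phi>\<^sub>0 (X p) = 0" if "p \<in> topspace M" for p
  proof (rule antisym)
    show "helicoid_fun k \<phi>\<^sub>0 (X p) \<le> 0"
      using helicoid_fun_nonpos[OF assms(8) assms(1) kr assms(9) _ that] zero_bd by simp
    have "helicoid_fun k (\<phi>\<^sub>0 + pi) (X p) \<le> 0"
      using helicoid_fun_nonpos[OF assms(8) assms(1) kr assms(9) _ that, of "\<phi>\<^sub>0 + pi"] zero_bd flip by simp
    then show "0 \<le> helicoid_fun k \<phi>\<^sub>0 (X p)" by (simp add: flip)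
  qed
  then show ?thesis
    unfolding k_def by (intro compact_surface_in_helicoid_eq_helicoid[OF assms(1,2,8,9) bd])
qed

end
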